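(* Let $m\ge 2$ and $n\ge 2$ be relatively prime integers. Then for any two real numbers $\beta,\beta'>1$ that are not integers, $\mu_{(\beta,n)}\neq\mu_{(\beta',m)}$.
   Context: For a real number $\gamma>1$ let $T_\gamma:[0,1)\to[0,1)$, $T_\gamma(x)=\gamma x \bmod 1$. For real $\beta>1$ and an integer $n\ge 2$, the alternate base transformation $K_{(\beta,n)}:\{0,1\}\times[0,1)\to\{0,1\}\times[0,1)$ is $K_{(\beta,n)}(0,x)=(1,T_\beta(x))$, $K_{(\beta,n)}(1,x)=(0,T_n(x))$. For reals $\gamma_1,\gamma_2>1$, $T_{\gamma_1\circ\gamma_2}:=T_{\gamma_1}\circ T_{\gamma_2}$ (a piecewise linear map of constant slope $\gamma_1\gamma_2$), and $\mu_{\gamma_1\circ\gamma_2}$ denotes its unique invariant probability measure absolutely continuous with respect to Lebesgue measure. The absolutely continuous invariant probability measure $\mu_{(\beta,n)}$ of $K_{(\beta,n)}$ is given by $\mu_{(\beta,n)}(\{0\}\times A\cup\{1\}\times B)=\tfrac12\mu_{n\circ\beta}(A)+\tfrac12\mu_{\beta\circ n}(B)$ for Borel $A,B\subseteq[0,1)$. *)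

theory Defs
  imports "HOL-Probability.Probability"
begin

definition Tmap :: "real \<Rightarrow> real \<Rightarrow> real" where
  "Tmap \<gamma> x = frac (\<gamma> * x)"

definition unit_leb :: "real measure" where
  "unit_leb = restrict_space lborel {0..<1}"

definition acim :: "(real \<Rightarrow> real) \<Rightarrow> real measure" where
  "acim f = (THE \<mu>. sets \<mu> = sets unit_leb \<and> prob_space \<mu> \<and>
       absolutely_continuous unit_leb \<mu> \<and> f \<in> measurable \<mu> \<mu> \<and> distr \<mu> \<mu> f = \<mu>)"

definition mu_comp :: "real \<Rightarrow> real \<Rightarrow> real measure" where
  "mu_comp \<gamma>1 \<gamma>2 = acim (Tmap \<gamma>1 \<circ> Tmap \<gamma>2)"

text \<open>The acim mu_{(beta,n)} of the alternate base transformation K_{(beta,n)} on {0,1} x [0,1):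
  mu({0} x A \<union> {1} x B) = 1/2 mu_{n o beta}(A) + 1/2 mu_{beta o n}(B).\<close>
definition alt_mu :: "real \<Rightarrow> nat \<Rightarrow> (nat \<times> real) measure" where
  "alt_mu \<beta> n = measure_of ({0,1} \<times> {0..<1})
      (sets (count_space {0::nat,1} \<Otimes>\<^sub>M unit_leb))
      (\<lambda>S. (1/2) * emeasure (mu_comp (real n) \<beta>) {x. (0,x) \<in> S}
         + (1/2) * emeasure (mu_comp \<beta> (real n)) {x. (1,x) \<in> S})"

end

theory Submission
  imports Defs
begin

text \<open>
  Put \<open>g = n \<beta>\<close> and \<open>t\<^sub>k = T\<^sub>g\<^sup>k 1\<close>. Since \<open>n\<close> is an integer, \<open>T\<^sub>n \<circ> T\<^sub>\<beta> = T\<^sub>g\<close>, whose absolutely continuous invariant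
  probability has Parry's density, a multiple of \<open>\<Sum>\<^sub>k g\<^sup>-\<^sup>k 1\<^bsub>[0, t\<^sub>k)\<^esub>\<close>; its image under \<open>T\<^sub>\<beta>\<close> is invariant
  under \<open>T\<^sub>\<beta> \<circ> T\<^sub>n\<close>. The jumps of the two densities can be read off from the measures.
  As \<open>g > 2\<close>, the largest jump inside \<open>(0, 1)\<close> sits at the fractional part of \<open>g\<close> for the first density
  and of \<open>\<beta>\<close> for the second, so equality of the measures for \<open>(\<beta>, n)\<close> and \<open>(\<beta>', m)\<close> makes
  \<open>\<beta> - \<beta>'\<close> and \<open>n \<beta> - m \<beta>'\<close>, hence also \<open>(n - m) \<beta>\<close>, integers. If \<open>n \<beta>\<close> is an integer, then so is \<open>m \<beta>\<close>,
  and by coprimality \<open>\<beta>\<close>. Otherwise \<open>g\<close> is a non-integral rational \<open>p / q\<close>, the reduced denominator of \<open>t\<^sub>k\<close>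
  is \<open>q\<^sup>k\<close>, so the \<open>t\<^sub>k\<close> are distinct and the sizes of the largest jumps give \<open>g = g'\<close> and \<open>\<beta> = \<beta>'\<close>,
  hence \<open>n = m\<close>.
\<close>

section \<open>Preimages under \<open>x \<mapsto> g x mod 1\<close>\<close>

lemma sets_unit_leb_iff: "E \<in> sets unit_leb \<longleftrightarrow> E \<in> sets borel \<and> E \<subseteq> {0..<1}"
  unfolding unit_leb_def by (auto simp: sets_restrict_space_iff)

lemma space_unit_leb [simp]: "space unit_leb = {0..<1}"
  by (simp add: unit_leb_def space_restrict_space)

lemma measure_unit_leb: "E \<in> sets unit_leb \<Longrightarrow> measure unit_leb E = measure lborel E"
  unfolding unit_leb_def
  by (subst measure_restrict_space) (auto simp: sets_restrict_space_iff)

lemma emeasure_unit_leb: "E \<in> sets unit_leb \<Longrightarrow> emeasure unit_leb E = emeasure lborel E"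
  unfolding unit_leb_def
  by (subst emeasure_restrict_space) (auto simp: sets_restrict_space_iff)

lemma prob_space_unit_leb: "prob_space unit_leb"
  by (rule prob_spaceI) (subst emeasure_unit_leb, auto simp: sets_unit_leb_iff)

interpretation unit_leb: prob_space unit_leb
  by (rule prob_space_unit_leb)

lemma frac_measurable [measurable]: "(frac :: real \<Rightarrow> real) \<in> borel_measurable borel"
  unfolding frac_def by measurable

lemma Tmap_borel_measurable [measurable]: "Tmap g \<in> borel_measurable borel"
  unfolding Tmap_def by measurable

lemma Tmap_range: "0 \<le> Tmap g x" "Tmap g x < 1"
  by (auto simp: Tmap_def frac_lt_1)

lemma Tmap_measurable: "Tmap g \<in> measurable unit_leb unit_leb"
  unfolding unit_leb_def
  by (intro measurable_restrict_space3) (auto simp: Tmap_range)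

lemma finite_lborel_subset:
  assumes "A \<in> sets borel" "A \<subseteq> {a..<b::real}"
  shows "emeasure lborel A < \<infinity>"
proof -
  have "emeasure lborel A \<le> emeasure lborel {a..<b}"
    using assms by (intro emeasure_mono) auto
  also have "\<dots> < \<infinity>" by (cases "a \<le> b") auto
  finally show ?thesis .
qed

lemma measure_lborel_translate:
  assumes "A \<in> sets borel"
  shows "measure lborel {x. x - c \<in> A} = measure lborel (A :: real set)"
proof -
  have "emeasure lborel A = emeasure (distr lborel borel ((+) (-c))) A"
    by (subst lborel_distr_plus) simp
  also have "\<dots> = emeasure lborel ((+) (-c) -` A \<inter> space lborel)"
    using assms by (subst emeasure_distr) auto
  also have "((+) (-c) -` A \<inter> space lborel) = {x. x - c \<in> A}"
    by auto
  finally show ?thesis by (simp add: measure_def)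
qed

lemma measure_lborel_scale:
  assumes "A \<in> sets borel" "c > 0"
  shows "measure lborel {x. c * x \<in> A} = measure lborel (A :: real set) / c"
proof -
  have "emeasure lborel {x. c * x \<in> A} = emeasure (distr lborel borel ((*) c)) A"
    using assms by (subst emeasure_distr) (auto intro: arg_cong2[where f = emeasure])
  also have "\<dots> = ennreal (inverse c) * emeasure lborel A"
    using assms by (subst lborel_distr_mult) (auto simp: emeasure_density nn_integral_cmult)
  finally show ?thesis
    using assms by (simp add: measure_def enn2real_mult divide_inverse)
qed

text \<open>Every full unit interval carries one translate of \<open>E\<close>, the remaining piece
  of length \<open>r\<close> only \<open>E \<inter> {0..<r}\<close>. The induction peels off the
  first unit interval and shifts the rest by 1, so the incomplete piece stays at the end.\<close>

lemma measure_frac_preimage: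
  assumes E: "E \<in> sets borel" "E \<subseteq> {0..<1}" and r: "0 \<le> r" "r < 1"
  shows "measure lborel {z\<in>{0..<real N + r}. frac z \<in> E}
       = real N * measure lborel E + measure lborel (E \<inter> {0..<r})"
proof (induction N)
  case 0
  have "{z\<in>{0..<real 0 + r}. frac z \<in> E} = E \<inter> {0..<r}"
    using r by (auto simp: frac_eq)
  then show ?case by simp
next
  case (Suc N)
  let ?B = "{z\<in>{0..<real N + r}. frac z \<in> E}"
  have B: "?B \<in> sets borel" using E(1) by measurable
  have "{z\<in>{0..<real (Suc N) + r}. frac z \<in> E} = E \<union> {z. z - 1 \<in> ?B}" (is "?L = ?R")
  proof (intro set_eqI iffI)
    fix z assume "z \<in> ?L"
    then have z: "0 \<le> z" "z < real N + 1 + r" "frac z \<in> E" by auto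
    show "z \<in> ?R"
    proof (cases "z < 1")
      case True
      then have "frac z = z" using z(1) by (simp add: frac_eq)
      then show ?thesis using z(3) by simp
    next
      case False
      have "frac (z - 1) = frac z" by (simp add: frac_def)
      then show ?thesis using z False by simp
    qed
  next
    fix z assume "z \<in> ?R"
    then consider "z \<in> E" | "z - 1 \<in> ?B" by blast
    then show "z \<in> ?L"
    proof cases
      case 1
      then have z: "0 \<le> z" "z < 1" using E(2) by auto
      then have "frac z = z" by (simp add: frac_eq)
      then show ?thesis using 1 z r by simp
    next
      case 2
      have "frac (z - 1) = frac z" by (simp add: frac_def)
      then show ?thesis using 2 by simp
    qed
  qed
  moreover have "measure lborel (E \<union> {z. z - 1 \<in> ?B}) =
      measure lborel E + measure lborel {z. z - 1 \<in> ?B}"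
  proof (rule measure_Union)
    show "emeasure lborel E \<noteq> \<infinity>" using finite_lborel_subset[OF E] by auto
    have "emeasure lborel {z. z - 1 \<in> ?B} < \<infinity>"
    proof (rule finite_lborel_subset)
      show "{z. z - 1 \<in> ?B} \<in> sets borel" using E(1) by measurable
      show "{z. z - 1 \<in> ?B} \<subseteq> {0..<real N + r + 1}" by auto
    qed
    then show "emeasure lborel {z. z - 1 \<in> ?B} \<noteq> \<infinity>" by auto
    show "{z. z - 1 \<in> ?B} \<in> sets lborel" using E(1) by measurable
  qed (use E in auto)
  ultimately show ?case
    using Suc measure_lborel_translate[OF B, of 1] by (simp add: algebra_simps)
qed

text \<open>The substitution \<open>z = g * x\<close> turns [0, a) into
  \<open>\<lfloor>g * a\<rfloor>\<close> full branches and one incomplete branch ending at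
  \<open>Tmap g a\<close>. Uniqueness of the invariant measure, invariance of Parry's measure and
  its transfer under \<open>Tmap \<beta>\<close> all rest on this count.\<close>

lemma measure_Tmap_preimage:
  assumes E: "E \<in> sets unit_leb" and g: "g > 0" and a: "0 \<le> a"
  shows "measure lborel {x\<in>{0..<a}. Tmap g x \<in> E}
       = (of_int \<lfloor>g * a\<rfloor> * measure lborel E + measure lborel (E \<inter> {0..<Tmap g a})) / g"
proof -
  have E': "E \<in> sets borel" "E \<subseteq> {0..<1}" using E by (auto simp: sets_unit_leb_iff)
  let ?N = "nat \<lfloor>g * a\<rfloor>"
  have "0 \<le> \<lfloor>g * a\<rfloor>" using g a by simp
  then have eq: "real ?N + Tmap g a = g * a"
    by (simp add: Tmap_def frac_def)
  let ?B = "{z\<in>{0..<g * a}. frac z \<in> E}"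
  have "{x\<in>{0..<a}. Tmap g x \<in> E} = {x. g * x \<in> ?B}"
    using g by (auto simp: Tmap_def zero_le_mult_iff)
  moreover have B: "?B \<in> sets borel" using E'(1) by measurable
  ultimately have "measure lborel {x\<in>{0..<a}. Tmap g x \<in> E} = measure lborel ?B / g"
    using measure_lborel_scale[OF B g] by simp
  also have "measure lborel ?B = real ?N * measure lborel E + measure lborel (E \<inter> {0..<Tmap g a})"
    using measure_frac_preimage[OF E' Tmap_range[of g a], of ?N] by (simp only: eq)
  also have "real ?N = of_int \<lfloor>g * a\<rfloor>" using g a by simp
  finally show ?thesis .
qed

section \<open>Uniqueness of the absolutely continuous invariant measure\<close>

text \<open>Testing against a generating pi-system is enough: a Dynkin argument gives all measurable
  sets, linearity the simple functions, and the uniform bound on \<open>\<phi>\<close> passes to L1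
  limits.\<close>

lemma (in finite_measure) weak_null_sequence:
  fixes \<phi> :: "nat \<Rightarrow> 'a \<Rightarrow> real"
  assumes meas [measurable]: "\<And>N. \<phi> N \<in> borel_measurable M"
    and bound: "\<And>N x. \<bar>\<phi> N x\<bar> \<le> 1"
    and sets: "sets M = sigma_sets (space M) G" "Int_stable G" "G \<subseteq> Pow (space M)"
    and gen: "\<And>A. A \<in> G \<Longrightarrow> (\<lambda>N. \<integral>x. indicator A x * \<phi> N x \<partial>M) \<longlonglongrightarrow> 0"
    and univ: "(\<lambda>N. \<integral>x. \<phi> N x \<partial>M) \<longlonglongrightarrow> 0"
    and f: "integrable M f"
  shows "(\<lambda>N. \<integral>x. f x * \<phi> N x \<partial>M) \<longlonglongrightarrow> 0"
proof -
  have int: "integrable M (\<lambda>x. h x * \<phi> N x)" if "integrable M h" for h N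
    by (rule Bochner_Integration.integrable_bound[OF that])
       (use that bound in \<open>auto simp: abs_mult intro!: AE_I2 mult_left_le\<close>)
  have int1: "integrable M (\<phi> N)" for N
    using int[of "\<lambda>_. 1" N] by simp
  have le: "\<bar>\<integral>x. h x * \<phi> N x \<partial>M\<bar> \<le> (\<integral>x. \<bar>h x\<bar> \<partial>M)" if h: "integrable M h" for h N
  proof -
    have "\<bar>\<integral>x. h x * \<phi> N x \<partial>M\<bar> \<le> (\<integral>x. \<bar>h x * \<phi> N x\<bar> \<partial>M)"
      by (rule integral_abs_bound)
    also have "\<dots> \<le> (\<integral>x. \<bar>h x\<bar> \<partial>M)"
      using bound by (intro integral_mono integrable_abs int h)
        (auto simp: abs_mult intro!: mult_left_le)
    finally show ?thesis .
  qed
  have ind: "(\<lambda>N. \<integral>x. indicator A x * \<phi> N x \<partial>M) \<longlonglongrightarrow> 0" if A: "A \<in> sets M" for A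
    using \<open>Int_stable G\<close> \<open>G \<subseteq> Pow (space M)\<close> A[unfolded sets(1)]
  proof (induction rule: sigma_sets_induct_disjoint)
    case (basic A)
    then show ?case by (rule gen)
  next
    case empty
    then show ?case by simp
  next
    case (compl A)
    have A: "A \<in> sets M" using compl sets(1) by simp
    have "(\<integral>x. indicator (space M - A) x * \<phi> N x \<partial>M)
        = (\<integral>x. \<phi> N x \<partial>M) - (\<integral>x. indicator A x * \<phi> N x \<partial>M)" for N
    proof -
      have "(\<integral>x. indicator (space M - A) x * \<phi> N x \<partial>M)
          = (\<integral>x. \<phi> N x - indicator A x * \<phi> N x \<partial>M)"
        by (rule Bochner_Integration.integral_cong) (auto simp: indicator_def)
      also have "\<dots> = (\<integral>x. \<phi> N x \<partial>M) - (\<integral>x. indicator A x * \<phi> N x \<partial>M)"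
        by (rule Bochner_Integration.integral_diff) (use A int1 int in \<open>auto simp: less_top[symmetric]\<close>)
      finally show ?thesis .
    qed
    then show ?case using tendsto_diff[OF univ compl(2)] by simp
  next
    case (union A)
    have A: "A i \<in> sets M" for i using union(2) sets(1) by auto
    have intA: "integrable M (indicator (A i) :: _ \<Rightarrow> real)" for i
      using A by (simp add: less_top[symmetric])
    have sumA: "(\<lambda>i. measure M (A i)) sums measure M (\<Union>i. A i)"
      using A union(1) by (intro finite_measure_UNION) auto
    have leA: "\<bar>\<integral>x. indicator (A i) x * \<phi> N x \<partial>M\<bar> \<le> measure M (A i)" for i N
      using le[OF intA, of i N] A sets.sets_into_space[OF A, of i]
      by (simp add: Int_absorb2)
    have sums: "(\<integral>x. indicator (\<Union>i. A i) x * \<phi> N x \<partial>M)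
        = (\<Sum>i. \<integral>x. indicator (A i) x * \<phi> N x \<partial>M)" for N
    proof -
      have "set_lebesgue_integral M (\<Union>i. A i) (\<phi> N) = (\<Sum>i. set_lebesgue_integral M (A i) (\<phi> N))"
      proof (rule lebesgue_integral_countable_add)
        show "A i \<inter> A j = {}" if "i \<noteq> j" for i j
          using union(1) that by (auto simp: disjoint_family_on_def)
        have "(\<Union>i. A i) \<in> sets M" using A by blast
        then have "integrable M (indicator (\<Union>i. A i) :: _ \<Rightarrow> real)"
          by (simp add: less_top[symmetric])
        then show "set_integrable M (\<Union>i. A i) (\<phi> N)"
          unfolding set_integrable_def using int by simp
      qed (use A in auto)
      then show ?thesis by (simp add: set_lebesgue_integral_def)
    qed
    \<comment> \<open>The masses of the disjoint sets \<open>A i\<close> form a summable majorant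
      uniform in \<open>N\<close>, so the limit in \<open>N\<close> may be taken inside the
      sum.\<close>
    have "eventually (\<lambda>(i, N). norm (\<integral>x. indicator (A i) x * \<phi> N x \<partial>M) \<le> measure M (A i))
        (sequentially \<times>\<^sub>F sequentially)"
      using leA by (intro always_eventually) auto
    from tannerys_theorem[OF union(3) this]
    have "(\<lambda>N. \<Sum>i. \<integral>x. indicator (A i) x * \<phi> N x \<partial>M) \<longlonglongrightarrow> (\<Sum>i. 0)"
      using sumA by (simp add: sums_iff)
    then show ?case unfolding sums by simp
  qed
  show ?thesis using f
  proof (induction rule: integrable_induct)
    case (base A c)
    have "(\<integral>x. (indicator A x *\<^sub>R c) * \<phi> N x \<partial>M) = c * (\<integral>x. indicator A x * \<phi> N x \<partial>M)" for N
      by (subst integral_mult_right_zero[symmetric]) (simp only: real_scaleR_def mult_ac)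
    then show ?case using tendsto_mult_left[OF ind[OF base(1)], of c] by simp
  next
    case (add f g)
    have "(\<integral>x. (f x + g x) * \<phi> N x \<partial>M)
        = (\<integral>x. f x * \<phi> N x \<partial>M) + (\<integral>x. g x * \<phi> N x \<partial>M)" for N
      unfolding distrib_right by (rule Bochner_Integration.integral_add) (intro int add)+
    then show ?case using tendsto_add[OF add(3,4)] by simp
  next
    case (lim f s)
    \<comment> \<open>The approximating simple functions satisfy
      \<open>\<bar>s i x\<bar> \<le> 2 * \<bar>f x\<bar>\<close>, whence the dominating function
      \<open>3 * \<bar>f x\<bar>\<close>.\<close>
    have "(\<lambda>i. \<integral>x. \<bar>f x - s i x\<bar> \<partial>M) \<longlonglongrightarrow> (\<integral>x. 0 \<partial>M)"
    proof (rule integral_dominated_convergence[where w = "\<lambda>x. 3 * \<bar>f x\<bar>"])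
      show "integrable M (\<lambda>x. 3 * \<bar>f x\<bar>)" using lim by auto
      show "AE x in M. (\<lambda>i. \<bar>f x - s i x\<bar>) \<longlonglongrightarrow> 0"
      proof (rule AE_I2)
        fix x assume "x \<in> space M"
        then show "(\<lambda>i. \<bar>f x - s i x\<bar>) \<longlonglongrightarrow> 0"
          using tendsto_diff[OF tendsto_const lim(2), of x "f x"]
          by (intro tendsto_rabs_zero) simp
      qed
      show "AE x in M. norm \<bar>f x - s i x\<bar> \<le> 3 * \<bar>f x\<bar>" for i
      proof (rule AE_I2)
        fix x assume "x \<in> space M"
        then show "norm \<bar>f x - s i x\<bar> \<le> 3 * \<bar>f x\<bar>"
          using lim(3)[of x i] by (simp add: abs_if split: if_splits)
      qed
    qed (use lim in auto)
    then have L1: "(\<lambda>i. \<integral>x. \<bar>f x - s i x\<bar> \<partial>M) \<longlonglongrightarrow> 0" by simp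
    show ?case
    proof (rule LIMSEQ_I)
      fix r :: real assume r: "r > 0"
      obtain i where i: "(\<integral>x. \<bar>f x - s i x\<bar> \<partial>M) < r / 2"
        using order_tendstoD(2)[OF L1, of "r/2"] r by (auto simp: eventually_sequentially)
      obtain N0 where N0: "\<And>N. N \<ge> N0 \<Longrightarrow> \<bar>\<integral>x. s i x * \<phi> N x \<partial>M\<bar> < r / 2"
        using LIMSEQ_D[OF lim(5), of "r/2" i] r by auto
      have "\<bar>\<integral>x. f x * \<phi> N x \<partial>M\<bar> < r" if "N \<ge> N0" for N
      proof -
        have "(\<integral>x. f x * \<phi> N x \<partial>M)
            = (\<integral>x. (f x - s i x) * \<phi> N x + s i x * \<phi> N x \<partial>M)"
          by (simp add: algebra_simps)
        also have "\<dots> = (\<integral>x. (f x - s i x) * \<phi> N x \<partial>M) + (\<integral>x. s i x * \<phi> N x \<partial>M)"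
          by (intro Bochner_Integration.integral_add int Bochner_Integration.integrable_diff lim)
        finally show ?thesis
          using le[of "\<lambda>x. f x - s i x" N] i N0[OF that] lim by auto
      qed
      then show "\<exists>no. \<forall>n\<ge>no. norm ((\<integral>x. f x * \<phi> n x \<partial>M) - 0) < r" by auto
    qed
  qed
qed

section \<open>Lebesgue mass of iterated preimages\<close>

text \<open>The endpoint \<open>a\<close> is a variable because the recursion in \<open>j\<close>
  moves it to \<open>Tmap g a\<close>.\<close>

definition iter_mass :: "(real \<Rightarrow> real) \<Rightarrow> real set \<Rightarrow> nat \<Rightarrow> real \<Rightarrow> real" where
  "iter_mass f E j a = measure lborel {x\<in>{0..<a}. (f ^^ j) x \<in> E}"

lemma funpow_borel_measurable:
  fixes f :: "real \<Rightarrow> real"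
  assumes "f \<in> borel_measurable borel"
  shows "(f ^^ j) \<in> borel_measurable borel"
  by (rule measurable_compose_n) (use assms in simp)

lemma iter_preimage_sets:
  assumes "E \<in> sets unit_leb" "f \<in> borel_measurable borel" "a \<le> 1"
  shows "{x\<in>{0..<a}. (f ^^ j) x \<in> E} \<in> sets unit_leb"
proof -
  have [measurable]: "E \<in> sets borel" using assms by (simp add: sets_unit_leb_iff)
  have [measurable]: "(f ^^ j) \<in> borel_measurable borel"
    by (rule funpow_borel_measurable[OF assms(2)])
  have "{x\<in>{0..<a}. (f ^^ j) x \<in> E} \<in> sets borel" by measurable
  then show ?thesis using assms(3) by (auto simp: sets_unit_leb_iff)
qed

lemma iter_mass_bounds:
  assumes "E \<in> sets unit_leb" "f \<in> borel_measurable borel" "a \<le> 1"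
  shows "0 \<le> iter_mass f E j a" "iter_mass f E j a \<le> 1"
proof -
  have "iter_mass f E j a = measure unit_leb {x\<in>{0..<a}. (f ^^ j) x \<in> E}"
    unfolding iter_mass_def by (rule measure_unit_leb[symmetric]) (rule iter_preimage_sets[OF assms])
  then show "0 \<le> iter_mass f E j a" "iter_mass f E j a \<le> 1" by simp_all
qed

lemma iter_mass_Suc:
  assumes E: "E \<in> sets unit_leb" and g: "g > 0" and a: "0 \<le> a"
  shows "iter_mass (Tmap g) E (Suc j) a
       = (of_int \<lfloor>g * a\<rfloor> * iter_mass (Tmap g) E j 1 + iter_mass (Tmap g) E j (Tmap g a)) / g"
proof -
  let ?E = "{x\<in>{0..<1}. (Tmap g ^^ j) x \<in> E}"
  have "?E \<in> sets unit_leb" by (rule iter_preimage_sets[OF E]) auto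
  from measure_Tmap_preimage[OF this g a]
  have "measure lborel {x\<in>{0..<a}. Tmap g x \<in> ?E} =
    (of_int \<lfloor>g * a\<rfloor> * measure lborel ?E + measure lborel (?E \<inter> {0..<Tmap g a})) / g" .
  moreover have "{x\<in>{0..<a}. Tmap g x \<in> ?E} = {x\<in>{0..<a}. (Tmap g ^^ Suc j) x \<in> E}"
    unfolding funpow_Suc_right comp_def using Tmap_range[of g] by auto
  moreover have "?E \<inter> {0..<Tmap g a} = {x\<in>{0..<Tmap g a}. (Tmap g ^^ j) x \<in> E}"
    using Tmap_range(2)[of g a] by auto
  ultimately show ?thesis by (simp only: iter_mass_def)
qed

text \<open>Inserting \<open>\<lfloor>g * a\<rfloor> = g * a - Tmap g a\<close> into the recursion
  cancels the full-branch sums up to boundary terms of modulus at most 1 and leaves the discrepancy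
  at \<open>Tmap g a\<close> divided by \<open>g\<close>. The bound solves
  \<open>d = 1 + d / g\<close> and is uniform in \<open>N\<close>.\<close>

lemma iter_mass_discrepancy:
  assumes E: "E \<in> sets unit_leb" and g: "g > 1" and a: "0 \<le> a" "a \<le> 1"
  shows "\<bar>(\<Sum>j<N. iter_mass (Tmap g) E j a) - a * (\<Sum>j<N. iter_mass (Tmap g) E j 1)\<bar> \<le> g / (g - 1)"
  using a
proof (induction N arbitrary: a)
  case 0
  then show ?case using g by simp
next
  case (Suc N)
  let ?u = "iter_mass (Tmap g) E"
  let ?S = "\<lambda>a. \<Sum>j<N. ?u j a"
  have fl: "of_int \<lfloor>g * a\<rfloor> = g * a - Tmap g a" by (simp add: Tmap_def frac_def)
  have "(\<Sum>j<Suc N. ?u j a) = ?u 0 a + (\<Sum>j<N. ?u (Suc j) a)"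
    by (rule sum.lessThan_Suc_shift)
  also have "(\<Sum>j<N. ?u (Suc j) a) = (of_int \<lfloor>g * a\<rfloor> * ?S 1 + ?S (Tmap g a)) / g"
    using iter_mass_Suc[OF E _ Suc.prems(1), of g] g
    by (simp add: sum_divide_distrib[symmetric] sum.distrib sum_distrib_left)
  finally have sum_Suc: "(\<Sum>j<Suc N. ?u j a)
      = ?u 0 a + ((g * a - Tmap g a) * ?S 1 + ?S (Tmap g a)) / g"
    unfolding fl .
  have "(\<Sum>j<Suc N. ?u j a) - a * (\<Sum>j<Suc N. ?u j 1)
      = ?u 0 a + ((g * a - Tmap g a) * ?S 1 + ?S (Tmap g a)) / g - a * (?S 1 + ?u N 1)"
    unfolding sum_Suc by simp
  also have "\<dots> = (?u 0 a - a * ?u N 1) + (?S (Tmap g a) - Tmap g a * ?S 1) / g"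
    using g by (simp add: add_divide_distrib diff_divide_distrib algebra_simps)
  finally have eq: "(\<Sum>j<Suc N. ?u j a) - a * (\<Sum>j<Suc N. ?u j 1)
      = (?u 0 a - a * ?u N 1) + (?S (Tmap g a) - Tmap g a * ?S 1) / g" .
  have "\<bar>?S (Tmap g a) - Tmap g a * ?S 1\<bar> / g \<le> (g / (g - 1)) / g"
    using Suc.IH[of "Tmap g a"] Tmap_range[of g a] g by (intro divide_right_mono) auto
  moreover have "\<bar>?u 0 a - a * ?u N 1\<bar> \<le> 1"
  proof -
    have "0 \<le> a * ?u N 1" "a * ?u N 1 \<le> 1"
      using Suc.prems iter_mass_bounds[OF E, of "Tmap g" 1 N] by (auto intro: mult_le_one)
    then show ?thesis using iter_mass_bounds[OF E, of "Tmap g" a 0] Suc.prems by auto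
  qed
  moreover have "1 + (g / (g - 1)) / g = g / (g - 1)" using g by (simp add: field_simps)
  ultimately show ?case
    unfolding eq using g
      abs_triangle_ineq[of "?u 0 a - a * ?u N 1" "(?S (Tmap g a) - Tmap g a * ?S 1) / g"]
    by (simp add: abs_divide)
qed

section \<open>Invariant measures, their densities and uniqueness\<close>

text \<open>The predicate under \<open>THE\<close> in \<open>acim\<close>, named so that existence
  and uniqueness can be treated separately.\<close>

definition is_acim :: "(real \<Rightarrow> real) \<Rightarrow> real measure \<Rightarrow> bool" where
  "is_acim f \<mu> \<longleftrightarrow> sets \<mu> = sets unit_leb \<and> prob_space \<mu> \<and>
       absolutely_continuous unit_leb \<mu> \<and> f \<in> measurable \<mu> \<mu> \<and> distr \<mu> \<mu> f = \<mu>"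

lemma acim_eqI:
  assumes "is_acim f \<mu>" "\<And>\<nu>. is_acim f \<nu> \<Longrightarrow> \<nu> = \<mu>"
  shows "acim f = \<mu>"
proof -
  have "acim f = (THE \<mu>. is_acim f \<mu>)" by (simp only: acim_def is_acim_def)
  also have "\<dots> = \<mu>" using assms by (rule the_equality)
  finally show ?thesis .
qed

lemma is_acim_space: "is_acim f \<mu> \<Longrightarrow> space \<mu> = {0..<1}"
  by (metis is_acim_def sets_eq_imp_space_eq space_unit_leb)

lemma is_acim_preimage:
  assumes "is_acim f \<mu>" "E \<in> sets unit_leb"
  shows "measure \<mu> {x\<in>{0..<1}. f x \<in> E} = measure \<mu> E"
proof -
  have \<mu>: "distr \<mu> \<mu> f = \<mu>" "f \<in> measurable \<mu> \<mu>" "E \<in> sets \<mu>"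
    using assms unfolding is_acim_def by blast+
  have "f -` E \<inter> space \<mu> = {x\<in>{0..<1}. f x \<in> E}"
    unfolding is_acim_space[OF assms(1)] by auto
  then show ?thesis
    using measure_distr[OF \<mu>(2,3)] unfolding \<mu>(1) by simp
qed

lemma is_acim_iter_preimage:
  assumes \<mu>: "is_acim f \<mu>" and f: "f \<in> borel_measurable borel" and E: "E \<in> sets unit_leb"
  shows "measure \<mu> {x\<in>{0..<1}. (f ^^ j) x \<in> E} = measure \<mu> E"
proof (induction j)
  case 0
  have "{x\<in>{0..<1}. (f ^^ 0) x \<in> E} = E" using E by (auto simp: sets_unit_leb_iff)
  then show ?case by simp
next
  case (Suc j)
  let ?E = "{x\<in>{0..<1}. (f ^^ j) x \<in> E}"
  have "f x \<in> {0..<1}" if "x \<in> {0..<1}" for x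
    using \<mu> that measurable_space[of f \<mu> \<mu> x] is_acim_space[OF \<mu>] by (simp add: is_acim_def)
  then have "{x\<in>{0..<1}. (f ^^ Suc j) x \<in> E} = {x\<in>{0..<1}. f x \<in> ?E}"
    unfolding funpow_Suc_right comp_def by auto
  then show ?case
    using is_acim_preimage[OF \<mu> iter_preimage_sets[OF E f], of 1 j] Suc by simp
qed

lemma is_acim_density:
  assumes "is_acim f \<mu>"
  obtains D where "integrable unit_leb D" "\<And>x. 0 \<le> D x" "\<mu> = density unit_leb (\<lambda>x. ennreal (D x))"
proof -
  interpret \<mu>: prob_space \<mu> using assms by (simp add: is_acim_def)
  have ac: "absolutely_continuous unit_leb \<mu>" "sets \<mu> = sets unit_leb"
    using assms by (auto simp: is_acim_def)
  obtain D where D: "D \<in> borel_measurable unit_leb"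
     "AE x in unit_leb. RN_deriv unit_leb \<mu> x = ennreal (D x)" "\<And>x. 0 \<le> D x"
    using unit_leb.real_RN_deriv[OF \<mu>.finite_measure_axioms ac] by metis
  have "\<mu> = density unit_leb (RN_deriv unit_leb \<mu>)"
    using unit_leb.density_RN_deriv[OF ac] by simp
  also have "\<dots> = density unit_leb (\<lambda>x. ennreal (D x))"
    by (rule density_cong) (use D in auto)
  finally have eq: "\<mu> = density unit_leb (\<lambda>x. ennreal (D x))" .
  have "integrable (density unit_leb (\<lambda>x. ennreal (D x))) (\<lambda>_. 1::real)"
    using \<mu>.integrable_const[of "1::real"] eq by simp
  then have "integrable unit_leb D"
    using D by (subst (asm) integrable_real_density) auto
  then show ?thesis using that D eq by blast
qed

text \<open>Lebesgue averages of the preimages of \<open>E\<close> converge to its mass under any absolutely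
  continuous invariant measure, which is therefore determined by the map.\<close>

lemma is_acim_Tmap_average:
  assumes \<mu>: "is_acim (Tmap g) \<mu>" and g: "g > 1" and E: "E \<in> sets unit_leb"
  shows "(\<lambda>N. (\<Sum>j<N. iter_mass (Tmap g) E j 1) / real N) \<longlonglongrightarrow> measure \<mu> E"
proof -
  let ?u = "\<lambda>j. iter_mass (Tmap g) E j 1"
  define Ej where "Ej j = {x\<in>{0..<1}. (Tmap g ^^ j) x \<in> E}" for j
  \<comment> \<open>\<open>\<phi> N\<close> averages the centred indicators of the first
    \<open>N\<close> preimages. Its Lebesgue integral is 0, whereas its integral under
    \<open>\<mu>\<close> is \<open>measure \<mu> E\<close> minus the Lebesgue average.\<close>
  define \<phi> where "\<phi> N x = (\<Sum>j<N. indicator (Ej j) x - ?u j) / real N" for N and x :: real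
  have Ej: "Ej j \<in> sets unit_leb" for j
    unfolding Ej_def by (rule iter_preimage_sets[OF E]) auto
  have sets_\<mu>: "sets \<mu> = sets unit_leb" using \<mu> by (simp add: is_acim_def)
  interpret \<mu>: prob_space \<mu> using \<mu> by (simp add: is_acim_def)
  have Ej_\<mu>: "Ej j \<in> sets \<mu>" for j using Ej sets_\<mu> by simp
  have u: "0 \<le> ?u j" "?u j \<le> 1" for j
    using iter_mass_bounds[OF E, of "Tmap g" 1 j] by auto
  have \<phi>_meas: "\<phi> N \<in> borel_measurable unit_leb" for N
    unfolding \<phi>_def using Ej by measurable
  have bound: "\<bar>\<phi> N x\<bar> \<le> 1" for N x
  proof (cases "N = 0")
    case False
    have "\<bar>\<Sum>j<N. indicator (Ej j) x - ?u j\<bar> \<le> (\<Sum>j<N. \<bar>indicator (Ej j) x - ?u j\<bar>)"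
      by (rule sum_abs)
    also have "\<dots> \<le> (\<Sum>j<N. 1)"
    proof (rule sum_mono)
      fix j show "\<bar>indicator (Ej j) x - ?u j\<bar> \<le> 1"
        using u[of j] by (auto simp: indicator_def)
    qed
    finally show ?thesis using False by (simp add: \<phi>_def)
  qed (simp add: \<phi>_def)
  \<comment> \<open>On an initial interval the integral is the discrepancy bounded earlier, divided
    by \<open>N\<close>, and so tends to 0.\<close>
  have int_A: "(\<integral>x. indicator {0..<a} x * \<phi> N x \<partial>unit_leb)
      = ((\<Sum>j<N. iter_mass (Tmap g) E j a) - a * (\<Sum>j<N. ?u j)) / real N"
    if a: "0 \<le> a" "a \<le> 1" for a N
  proof -
    have A: "{0..<a} \<in> sets unit_leb" using a by (auto simp: sets_unit_leb_iff)
    have "(\<integral>x. indicator {0..<a} x * \<phi> N x \<partial>unit_leb)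
       = (\<integral>x. (\<Sum>j<N. indicator ({0..<a} \<inter> Ej j) x - ?u j * indicator {0..<a} x) / real N \<partial>unit_leb)"
      unfolding \<phi>_def
      by (intro Bochner_Integration.integral_cong)
         (auto simp: sum_distrib_left indicator_inter_arith algebra_simps)
    also have "\<dots> = (\<Sum>j<N. measure unit_leb ({0..<a} \<inter> Ej j) - ?u j * measure unit_leb {0..<a}) / real N"
    proof -
      have int: "has_bochner_integral unit_leb (indicator B :: real \<Rightarrow> real) (measure unit_leb B)"
        if "B \<in> sets unit_leb" for B
        using that by (intro has_bochner_integral_real_indicator) (auto simp: less_top[symmetric])
      have "{0..<a} \<inter> Ej j \<in> sets unit_leb" for j using A Ej by blast
      then have "has_bochner_integral unit_leb
          (\<lambda>x. (\<Sum>j<N. indicator ({0..<a} \<inter> Ej j) x - ?u j * indicator {0..<a} x) / real N)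
          ((\<Sum>j<N. measure unit_leb ({0..<a} \<inter> Ej j) - ?u j * measure unit_leb {0..<a}) / real N)"
        using A
        by (intro has_bochner_integral_divide_zero has_bochner_integral_sum has_bochner_integral_diff
            has_bochner_integral_mult_right int)
      then show ?thesis by (rule has_bochner_integral_integral_eq)
    qed
    also have "\<dots> = (\<Sum>j<N. iter_mass (Tmap g) E j a - ?u j * a) / real N"
    proof -
      have "measure unit_leb ({0..<a} \<inter> Ej j) = iter_mass (Tmap g) E j a" for j
      proof -
        have "{0..<a} \<inter> Ej j = {x\<in>{0..<a}. (Tmap g ^^ j) x \<in> E}" using a by (auto simp: Ej_def)
        moreover have "{0..<a} \<inter> Ej j \<in> sets unit_leb" using A Ej by blast
        ultimately show ?thesis by (simp only: iter_mass_def measure_unit_leb)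
      qed
      moreover have "measure unit_leb {0..<a} = a" using A a by (simp add: measure_unit_leb)
      ultimately show ?thesis by simp
    qed
    finally show ?thesis
      by (simp add: sum_subtractf sum_distrib_left mult.commute)
  qed
  have lim_A: "(\<lambda>N. \<integral>x. indicator {0..<a} x * \<phi> N x \<partial>unit_leb) \<longlonglongrightarrow> 0"
    if a: "0 \<le> a" "a \<le> 1" for a
  proof (rule Lim_null_comparison)
    show "\<forall>\<^sub>F N in sequentially. norm (\<integral>x. indicator {0..<a} x * \<phi> N x \<partial>unit_leb) \<le> (g / (g - 1)) / real N"
      unfolding int_A[OF a] real_norm_def abs_divide abs_of_nat
      by (intro always_eventually allI divide_right_mono iter_mass_discrepancy[OF E g a]) simp
    show "(\<lambda>N. (g / (g - 1)) / real N) \<longlonglongrightarrow> 0" by (rule lim_const_over_n)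
  qed
  obtain D where D: "integrable unit_leb D" "\<And>x. 0 \<le> D x" "\<mu> = density unit_leb (\<lambda>x. ennreal (D x))"
    using is_acim_density[OF \<mu>] by blast
  \<comment> \<open>The intervals [0, a) are an intersection-stable generator, so the density
    \<open>D\<close> itself becomes an admissible test function.\<close>
  have lim_D: "(\<lambda>N. \<integral>x. D x * \<phi> N x \<partial>unit_leb) \<longlonglongrightarrow> 0"
  proof (rule unit_leb.weak_null_sequence[OF \<phi>_meas bound, where G = "(\<lambda>a. {0..<a}) ` {0..1}"])
    show "sets unit_leb = sigma_sets (space unit_leb) ((\<lambda>a. {0..<a}) ` {0..1})"
    proof -
      have borel: "sets (borel :: real measure) = sigma_sets UNIV (range lessThan)"
        by (subst borel_eq_lessThan) (simp add: eucl_lessThan)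
      then have "sets unit_leb = ((\<inter>) {0..<1}) ` sigma_sets UNIV (range lessThan)"
        by (simp add: unit_leb_def sets_restrict_space)
      also have "\<dots> = sigma_sets {0..<1} (((\<inter>) {0..<1}) ` range lessThan)"
        by (rule sigma_sets_Int) (auto simp flip: borel)
      also have "((\<inter>) {0..<1}) ` range lessThan = (\<lambda>a. {0..<a}) ` {0..1::real}"
      proof (intro equalityI subsetI)
        fix X :: "real set" assume "X \<in> ((\<inter>) {0..<1}) ` range lessThan"
        then obtain b where "X = {0..<1} \<inter> {..<b}" by auto
        then have "X = {0..<max 0 (min 1 b)}" by auto
        then show "X \<in> (\<lambda>a. {0..<a}) ` {0..1}" by auto
      next
        fix X :: "real set" assume "X \<in> (\<lambda>a. {0..<a}) ` {0..1}"
        then obtain b where "b \<in> {0..1}" "X = {0..<b}" by auto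
        then have "X = {0..<1} \<inter> {..<b}" by auto
        then show "X \<in> ((\<inter>) {0..<1}) ` range lessThan" by blast
      qed
      finally show ?thesis by simp
    qed
    show "Int_stable ((\<lambda>a. {0..<a}) ` {0..1::real})"
    proof (rule Int_stableI_image)
      fix a b :: real assume "a \<in> {0..1}" "b \<in> {0..1}"
      then show "\<exists>c\<in>{0..1}. {0..<a} \<inter> {0..<b} = {0..<c}"
        by (intro bexI[of _ "min a b"]) auto
    qed
    show "(\<lambda>N. \<integral>x. \<phi> N x \<partial>unit_leb) \<longlonglongrightarrow> 0"
    proof -
      have "(\<integral>x. \<phi> N x \<partial>unit_leb) = (\<integral>x. indicator {0..<1} x * \<phi> N x \<partial>unit_leb)" for N
        by (rule Bochner_Integration.integral_cong) auto
      then show ?thesis using lim_A[of 1] by simp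
    qed
  qed (use lim_A D(1) in auto)
  \<comment> \<open>Invariance gives every preimage the mass of \<open>E\<close>. At
    \<open>N = 0\<close> division by zero makes the integral 0, hence the restriction to positive
    \<open>N\<close>.\<close>
  have eq: "(\<integral>x. D x * \<phi> N x \<partial>unit_leb) = measure \<mu> E - (\<Sum>j<N. ?u j) / real N" if "N > 0" for N
  proof -
    have "(\<integral>x. D x * \<phi> N x \<partial>unit_leb) = (\<integral>x. \<phi> N x \<partial>\<mu>)"
      unfolding D(3) by (rule integral_real_density[symmetric]) (use D \<phi>_meas in auto)
    also have "\<dots> = (\<Sum>j<N. measure \<mu> (Ej j) - ?u j * measure \<mu> (space \<mu>)) / real N"
    proof (rule has_bochner_integral_integral_eq)
      have int: "has_bochner_integral \<mu> (indicator B :: real \<Rightarrow> real) (measure \<mu> B)"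
        if "B \<in> sets \<mu>" for B
        using that by (intro has_bochner_integral_real_indicator) (auto simp: less_top[symmetric])
      have "has_bochner_integral \<mu>
          (\<lambda>x. (\<Sum>j<N. indicator (Ej j) x - ?u j * indicator (space \<mu>) x) / real N)
          ((\<Sum>j<N. measure \<mu> (Ej j) - ?u j * measure \<mu> (space \<mu>)) / real N)"
        using Ej_\<mu>
        by (intro has_bochner_integral_divide_zero has_bochner_integral_sum has_bochner_integral_diff
            has_bochner_integral_mult_right int) auto
      then show "has_bochner_integral \<mu> (\<phi> N)
          ((\<Sum>j<N. measure \<mu> (Ej j) - ?u j * measure \<mu> (space \<mu>)) / real N)"
        by (rule has_bochner_integral_cong[THEN iffD1, rotated -1]) (auto simp: \<phi>_def)
    qed
    also have "\<dots> = (\<Sum>j<N. measure \<mu> E - ?u j) / real N"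
      unfolding Ej_def using is_acim_iter_preimage[OF \<mu> _ E] by (simp add: \<mu>.prob_space)
    finally show ?thesis using that by (simp add: sum_subtractf diff_divide_distrib)
  qed
  from lim_D have "(\<lambda>N. measure \<mu> E - (\<Sum>j<N. ?u j) / real N) \<longlonglongrightarrow> 0"
    by (rule Lim_transform_eventually) (use eq in \<open>auto simp: eventually_sequentially intro!: exI[of _ 1]\<close>)
  from tendsto_diff[OF tendsto_const this, of "measure \<mu> E"] show ?thesis by simp
qed

lemma is_acim_Tmap_unique:
  assumes "is_acim (Tmap g) \<mu>" "is_acim (Tmap g) \<nu>" "g > 1"
  shows "\<mu> = \<nu>"
proof (rule measure_eqI)
  show "sets \<mu> = sets \<nu>" using assms by (simp add: is_acim_def)
  interpret \<mu>: prob_space \<mu> using assms by (simp add: is_acim_def)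
  interpret \<nu>: prob_space \<nu> using assms by (simp add: is_acim_def)
  fix A assume "A \<in> sets \<mu>"
  then have A: "A \<in> sets unit_leb" using assms by (simp add: is_acim_def)
  have "measure \<mu> A = measure \<nu> A"
    by (rule LIMSEQ_unique[OF is_acim_Tmap_average[OF assms(1,3) A] is_acim_Tmap_average[OF assms(2,3) A]])
  then show "emeasure \<mu> A = emeasure \<nu> A"
    by (simp add: \<mu>.emeasure_eq_measure \<nu>.emeasure_eq_measure)
qed

section \<open>Parry's density\<close>

text \<open>The starting point 1 lies outside [0, 1). It makes term 0 of Parry's density constant on
  the whole interval, while all later orbit points are below 1.\<close>

definition orbit_one :: "real \<Rightarrow> nat \<Rightarrow> real" where
  "orbit_one g k = (Tmap g ^^ k) 1"

lemma orbit_one_0 [simp]: "orbit_one g 0 = 1"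
  and orbit_one_Suc: "orbit_one g (Suc k) = Tmap g (orbit_one g k)"
  by (simp_all add: orbit_one_def)

lemma orbit_one_bounds: "0 \<le> orbit_one g k" "orbit_one g k \<le> 1"
  by (cases k; use Tmap_range in \<open>auto simp: orbit_one_Suc intro: less_imp_le\<close>)+

text \<open>Normalisation: term \<open>k\<close> of the unscaled density has Lebesgue integral
  \<open>orbit_one g k / g ^ k\<close>.\<close>

definition parry_const :: "real \<Rightarrow> real" where
  "parry_const g = 1 / (\<Sum>k. orbit_one g k / g ^ k)"

text \<open>The series is taken in \<open>ennreal\<close>, where nonnegative terms can be integrated
  one by one.\<close>

definition parry :: "real \<Rightarrow> real measure" where
  "parry g = density unit_leb
     (\<lambda>x. \<Sum>k. ennreal (parry_const g / g ^ k) * indicator {0..<orbit_one g k} x)"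

context
  fixes g :: real
  assumes g: "g > 1"
begin

lemma summable_geometric_weight: "summable (\<lambda>k. 1 / g ^ k)"
  using summable_geometric[of "1 / g"] g by (simp add: power_one_over)

lemma summable_weighted:
  assumes "\<And>k. 0 \<le> f k" "\<And>k. f k \<le> c"
  shows "summable (\<lambda>k. f k / g ^ k)"
proof (rule summable_comparison_test')
  show "summable (\<lambda>k. c * (1 / g ^ k))"
    by (intro summable_mult summable_geometric_weight)
  show "norm (f k / g ^ k) \<le> c * (1 / g ^ k)" for k
    using assms g by (auto intro!: divide_right_mono)
qed

lemma summable_orbit_one: "summable (\<lambda>k. orbit_one g k / g ^ k)"
  using orbit_one_bounds by (rule summable_weighted)

lemma parry_const_pos: "parry_const g > 0"
proof -
  have "(\<Sum>k. orbit_one g k / g ^ k) > 0"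
    by (rule suminf_pos2[of _ 0]) (use summable_orbit_one orbit_one_bounds g in auto)
  then show ?thesis by (simp add: parry_const_def)
qed

lemma sets_parry: "sets (parry g) = sets unit_leb"
  by (simp add: parry_def)

lemma emeasure_parry:
  assumes A: "A \<in> sets unit_leb"
  shows "emeasure (parry g) A
       = ennreal (\<Sum>k. parry_const g / g ^ k * measure lborel (A \<inter> {0..<orbit_one g k}))"
proof -
  have I: "A \<inter> {0..<orbit_one g k} \<in> sets unit_leb" for k
    using A by (auto simp: sets_unit_leb_iff)
  have [measurable]: "{0..<orbit_one g k} \<in> sets unit_leb" for k
    using orbit_one_bounds[of g k] by (auto simp: sets_unit_leb_iff)
  have m: "measure lborel (A \<inter> {0..<orbit_one g k}) = measure unit_leb (A \<inter> {0..<orbit_one g k})" for k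
    using measure_unit_leb[OF I] by simp
  have "emeasure (parry g) A =
     (\<integral>\<^sup>+x. (\<Sum>k. ennreal (parry_const g / g ^ k) * indicator {0..<orbit_one g k} x) * indicator A x \<partial>unit_leb)"
    unfolding parry_def by (rule emeasure_density) (use A in measurable)
  also have "\<dots> = (\<integral>\<^sup>+x. (\<Sum>k. ennreal (parry_const g / g ^ k) * indicator (A \<inter> {0..<orbit_one g k}) x) \<partial>unit_leb)"
    by (simp add: indicator_inter_arith mult_ac flip: ennreal_suminf_cmult)
  also have "\<dots> = (\<Sum>k. \<integral>\<^sup>+x. ennreal (parry_const g / g ^ k) * indicator (A \<inter> {0..<orbit_one g k}) x \<partial>unit_leb)"
    by (rule nn_integral_suminf) (use I in measurable)
  also have "\<dots> = (\<Sum>k. ennreal (parry_const g / g ^ k) * emeasure unit_leb (A \<inter> {0..<orbit_one g k}))"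
    using I by (simp add: nn_integral_cmult_indicator)
  also have "\<dots> = (\<Sum>k. ennreal (parry_const g / g ^ k * measure lborel (A \<inter> {0..<orbit_one g k})))"
  proof (rule suminf_cong)
    fix k
    have "0 \<le> parry_const g / g ^ k" using g parry_const_pos by simp
    then show "ennreal (parry_const g / g ^ k) * emeasure unit_leb (A \<inter> {0..<orbit_one g k})
        = ennreal (parry_const g / g ^ k * measure lborel (A \<inter> {0..<orbit_one g k}))"
      unfolding m unit_leb.emeasure_eq_measure by (rule ennreal_mult[symmetric]) simp
  qed
  also have "\<dots> = ennreal (\<Sum>k. parry_const g / g ^ k * measure lborel (A \<inter> {0..<orbit_one g k}))"
  proof (rule suminf_ennreal2)
    show "summable (\<lambda>k. parry_const g / g ^ k * measure lborel (A \<inter> {0..<orbit_one g k}))"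
      using summable_mult[OF summable_weighted[of "\<lambda>k. measure lborel (A \<inter> {0..<orbit_one g k})" 1], of "parry_const g"]
      unfolding m by simp
  qed (use g parry_const_pos in auto)
  finally show ?thesis .
qed

lemma measure_parry:
  assumes A: "A \<in> sets unit_leb"
  shows "measure (parry g) A
       = parry_const g * (\<Sum>k. measure lborel (A \<inter> {0..<orbit_one g k}) / g ^ k)"
proof -
  have "A \<inter> {0..<orbit_one g k} \<in> sets unit_leb" for k
    using A by (auto simp: sets_unit_leb_iff)
  then have m: "measure lborel (A \<inter> {0..<orbit_one g k}) = measure unit_leb (A \<inter> {0..<orbit_one g k})" for k
    using measure_unit_leb by simp
  have s: "summable (\<lambda>k. measure lborel (A \<inter> {0..<orbit_one g k}) / g ^ k)"
    unfolding m by (rule summable_weighted[of _ 1]) auto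
  have "0 \<le> (\<Sum>k. parry_const g / g ^ k * measure lborel (A \<inter> {0..<orbit_one g k}))"
    using summable_mult[OF s, of "parry_const g"] g parry_const_pos
    by (intro suminf_nonneg) (auto simp: field_simps)
  then have "measure (parry g) A
       = (\<Sum>k. parry_const g / g ^ k * measure lborel (A \<inter> {0..<orbit_one g k}))"
    using emeasure_parry[OF A] by (simp add: measure_def)
  also have "\<dots> = parry_const g * (\<Sum>k. measure lborel (A \<inter> {0..<orbit_one g k}) / g ^ k)"
    by (subst suminf_mult[OF s, symmetric]) simp
  finally show ?thesis .
qed

lemma prob_space_parry: "prob_space (parry g)"
proof (rule prob_spaceI)
  have sp: "space (parry g) = {0..<1}" by (simp add: parry_def)
  have *: "(\<Sum>k. orbit_one g k / g ^ k) > 0"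
    by (rule suminf_pos2[of _ 0]) (use summable_orbit_one orbit_one_bounds g in auto)
  have "measure lborel ({0..<1} \<inter> {0..<orbit_one g k}) = orbit_one g k" for k
    using orbit_one_bounds[of g k] by (simp add: Int_absorb1)
  then have "emeasure (parry g) {0..<1} = ennreal (\<Sum>k. parry_const g / g ^ k * orbit_one g k)"
    by (subst emeasure_parry) (auto simp: sets_unit_leb_iff)
  also have "(\<Sum>k. parry_const g / g ^ k * orbit_one g k) = parry_const g * (\<Sum>k. orbit_one g k / g ^ k)"
    by (subst suminf_mult[OF summable_orbit_one, symmetric]) simp
  also have "\<dots> = 1" using * by (simp add: parry_const_def)
  finally show "emeasure (parry g) (space (parry g)) = 1" by (simp add: sp)
qed

text \<open>Since \<open>\<lfloor>g t\<rfloor> = g t - T t\<close>, the full-branch contributions of consecutive terms telescope.\<close>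

lemma measure_parry_preimage:
  assumes E: "E \<in> sets unit_leb"
  shows "measure (parry g) {x\<in>{0..<1}. Tmap g x \<in> E} = measure (parry g) E"
proof -
  let ?t = "orbit_one g" and ?m = "\<lambda>k. measure lborel (E \<inter> {0..<orbit_one g k})"
  have Ep: "{x\<in>{0..<1}. Tmap g x \<in> E} \<in> sets unit_leb"
    using iter_preimage_sets[OF E, of "Tmap g" 1 1] by simp
  have I: "E \<inter> {0..<?t k} \<in> sets unit_leb" for k using E by (auto simp: sets_unit_leb_iff)
  have sm: "summable (\<lambda>k. ?m k / g ^ k)"
    by (rule summable_weighted[of _ 1]) (use measure_unit_leb[OF I, symmetric] in auto)
  have "E \<inter> {0..<?t 0} = E" using E by (auto simp: sets_unit_leb_iff)
  then have m0: "?m 0 = measure lborel E" by simp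
  have "measure lborel ({x\<in>{0..<1}. Tmap g x \<in> E} \<inter> {0..<?t k}) / g ^ k
      = (?t k / g ^ k - ?t (Suc k) / g ^ Suc k) * measure lborel E + ?m (Suc k) / g ^ Suc k" for k
  proof -
    have "{x\<in>{0..<1}. Tmap g x \<in> E} \<inter> {0..<?t k} = {x\<in>{0..<?t k}. Tmap g x \<in> E}"
      using orbit_one_bounds[of g k] by auto
    moreover have "of_int \<lfloor>g * ?t k\<rfloor> = g * ?t k - ?t (Suc k)"
      by (simp add: orbit_one_Suc Tmap_def frac_def)
    ultimately have "measure lborel ({x\<in>{0..<1}. Tmap g x \<in> E} \<inter> {0..<?t k})
        = ((g * ?t k - ?t (Suc k)) * measure lborel E + ?m (Suc k)) / g"
      using measure_Tmap_preimage[OF E _ orbit_one_bounds(1)[of g k], of g] g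
      by (simp only: orbit_one_Suc)
    then show ?thesis using g by (simp add: field_simps)
  qed
  \<comment> \<open>The telescoped coefficients sum to \<open>?t 0 = 1\<close>; multiplied by
    \<open>measure lborel E\<close> this restores exactly the term \<open>k = 0\<close> that the
    index shift removes from the series of \<open>?m\<close>.\<close>
  moreover have "(\<lambda>k. (?t k / g ^ k - ?t (Suc k) / g ^ Suc k) * measure lborel E + ?m (Suc k) / g ^ Suc k)
     sums ((?t 0 / g ^ 0 - 0) * measure lborel E + ((\<Sum>k. ?m k / g ^ k) - ?m 0 / g ^ 0))"
    by (intro sums_add sums_mult2 telescope_sums' summable_LIMSEQ_zero summable_orbit_one)
       (use sm sums_Suc_iff[of "\<lambda>k. ?m k / g ^ k"] in \<open>simp add: summable_sums\<close>)
  ultimately have "(\<lambda>k. measure lborel ({x\<in>{0..<1}. Tmap g x \<in> E} \<inter> {0..<?t k}) / g ^ k)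
     sums (\<Sum>k. ?m k / g ^ k)"
    using m0 by simp
  then show ?thesis
    unfolding measure_parry[OF E] measure_parry[OF Ep] by (simp add: sums_iff)
qed

lemma is_acim_parry: "is_acim (Tmap g) (parry g)"
proof -
  interpret p: prob_space "parry g" by (rule prob_space_parry)
  have sp: "space (parry g) = {0..<1}" by (simp add: parry_def)
  have [measurable]: "{0..<orbit_one g k} \<in> sets unit_leb" for k
    using orbit_one_bounds[of g k] by (auto simp: sets_unit_leb_iff)
  have meas: "Tmap g \<in> measurable (parry g) (parry g)"
    using Tmap_measurable sets_parry by (simp cong: measurable_cong_sets)
  have "distr (parry g) (parry g) (Tmap g) = parry g"
  proof (rule measure_eqI)
    fix A assume "A \<in> sets (distr (parry g) (parry g) (Tmap g))"
    then have A: "A \<in> sets unit_leb" by (simp add: sets_parry)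
    have "Tmap g -` A \<inter> space (parry g) = {x\<in>{0..<1}. Tmap g x \<in> A}" by (auto simp: sp)
    then show "emeasure (distr (parry g) (parry g) (Tmap g)) A = emeasure (parry g) A"
      using A measure_parry_preimage[OF A]
      by (subst emeasure_distr[OF meas]) (simp_all add: sets_parry p.emeasure_eq_measure)
  qed simp
  moreover have "absolutely_continuous unit_leb (parry g)"
    unfolding parry_def by (rule absolutely_continuousI_density) measurable
  ultimately show ?thesis
    unfolding is_acim_def using sets_parry prob_space_parry meas by blast
qed

lemma acim_Tmap: "acim (Tmap g) = parry g"
  using is_acim_parry is_acim_Tmap_unique g by (blast intro: acim_eqI)

end

section \<open>The measures of the alternate base transformation\<close>

text \<open>As \<open>n\<close> is an integer, discarding the integer part of
  \<open>\<beta> * x\<close> changes the product with \<open>n\<close> by an integer.\<close>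

lemma Tmap_comp_Tmap: "Tmap (real n) \<circ> Tmap \<beta> = Tmap (real n * \<beta>)"
proof
  fix x
  have "real n * frac (\<beta> * x) = real n * \<beta> * x - of_int (int n * \<lfloor>\<beta> * x\<rfloor>)"
    by (simp add: frac_def algebra_simps)
  then have "frac (real n * frac (\<beta> * x)) = frac (real n * \<beta> * x)"
    by (simp only: frac_def floor_diff_of_int of_int_diff)
  then show "(Tmap (real n) \<circ> Tmap \<beta>) x = Tmap (real n * \<beta>) x"
    by (simp only: Tmap_def comp_def)
qed

text \<open>\<open>Tmap \<beta>\<close> semiconjugates \<open>f \<circ> Tmap \<beta>\<close> to
  \<open>Tmap \<beta> \<circ> f\<close>, so pushing forward along it preserves invariance. Absolute
  continuity survives because, by the branch count, Lebesgue null sets have null preimages under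
  \<open>Tmap \<beta>\<close>.\<close>

lemma is_acim_comp_commute:
  assumes \<mu>: "is_acim (f \<circ> Tmap \<beta>) \<mu>" and f: "f \<in> measurable unit_leb unit_leb" and \<beta>: "\<beta> > 0"
  shows "is_acim (Tmap \<beta> \<circ> f) (distr \<mu> unit_leb (Tmap \<beta>))"
proof -
  have s: "sets \<mu> = sets unit_leb" and ac: "absolutely_continuous unit_leb \<mu>"
    and inv: "distr \<mu> \<mu> (f \<circ> Tmap \<beta>) = \<mu>"
    using \<mu> by (simp_all only: is_acim_def)
  interpret prob_space \<mu> using \<mu> by (simp only: is_acim_def)
  have m: "Tmap \<beta> \<in> measurable \<mu> unit_leb"
    using Tmap_measurable s by (simp cong: measurable_cong_sets)
  have f\<mu>: "f \<in> measurable unit_leb \<mu>"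
    using f s by (simp cong: measurable_cong_sets)
  let ?\<nu> = "distr \<mu> unit_leb (Tmap \<beta>)"
  have m\<nu>: "Tmap \<beta> \<circ> f \<in> measurable ?\<nu> ?\<nu>"
    using measurable_comp[OF f Tmap_measurable] by (simp cong: measurable_cong_sets)
  have "absolutely_continuous unit_leb ?\<nu>"
    unfolding absolutely_continuous_def
  proof
    fix A assume A: "A \<in> null_sets unit_leb"
    then have A': "A \<in> sets unit_leb" by auto
    then have pre: "{x\<in>{0..<1}. Tmap \<beta> x \<in> A} \<in> sets unit_leb"
      using iter_preimage_sets[of A "Tmap \<beta>" 1 1] by simp
    have zero: "measure lborel A = 0"
      using A measure_unit_leb[OF A'] by (simp add: measure_def null_setsD1)
    have "measure lborel (A \<inter> {0..<Tmap \<beta> 1}) = 0"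
    proof -
      have I: "A \<inter> {0..<Tmap \<beta> 1} \<in> sets unit_leb" using A' by (auto simp: sets_unit_leb_iff)
      have "measure unit_leb (A \<inter> {0..<Tmap \<beta> 1}) \<le> measure unit_leb A"
        using A' by (intro unit_leb.finite_measure_mono) auto
      then show ?thesis
        using zero measure_unit_leb[OF A'] measure_unit_leb[OF I]
        by (metis measure_nonneg order_antisym)
    qed
    then have "measure lborel {x\<in>{0..<1}. Tmap \<beta> x \<in> A} = 0"
      using measure_Tmap_preimage[OF A' \<beta>, of 1] zero by simp
    then have "emeasure unit_leb {x\<in>{0..<1}. Tmap \<beta> x \<in> A} = 0"
      using measure_unit_leb[OF pre] unit_leb.emeasure_eq_measure by simp
    then have "emeasure \<mu> {x\<in>{0..<1}. Tmap \<beta> x \<in> A} = 0"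
      using absolutely_continuousD[OF ac pre] by simp
    moreover have "Tmap \<beta> -` A \<inter> space \<mu> = {x\<in>{0..<1}. Tmap \<beta> x \<in> A}"
      unfolding is_acim_space[OF \<mu>] by auto
    ultimately have "emeasure ?\<nu> A = 0"
      by (simp add: emeasure_distr[OF m A'])
    then show "A \<in> null_sets ?\<nu>" using A' by (simp add: null_sets_def)
  qed
  moreover have "distr ?\<nu> ?\<nu> (Tmap \<beta> \<circ> f) = ?\<nu>"
  proof -
    have "distr ?\<nu> ?\<nu> (Tmap \<beta> \<circ> f) = distr ?\<nu> unit_leb (Tmap \<beta> \<circ> f)"
      by (rule distr_cong) simp_all
    also have "\<dots> = distr \<mu> unit_leb ((Tmap \<beta> \<circ> f) \<circ> Tmap \<beta>)"
      by (rule distr_distr[OF measurable_comp[OF f Tmap_measurable] m])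
    also have "(Tmap \<beta> \<circ> f) \<circ> Tmap \<beta> = Tmap \<beta> \<circ> (f \<circ> Tmap \<beta>)"
      by (rule comp_assoc)
    \<comment> \<open>After regrouping, \<open>f \<circ> Tmap \<beta>\<close> acts first on
      \<open>\<mu>\<close> and is absorbed by invariance.\<close>
    also have "distr \<mu> unit_leb \<dots> = distr (distr \<mu> \<mu> (f \<circ> Tmap \<beta>)) unit_leb (Tmap \<beta>)"
      by (rule distr_distr[symmetric, OF m measurable_comp[OF m f\<mu>]])
    also have "\<dots> = ?\<nu>" by (simp only: inv)
    finally show ?thesis .
  qed
  ultimately show ?thesis
    unfolding is_acim_def using prob_space_distr[OF m] m\<nu> by (simp only: sets_distr simp_thms)
qed

section \<open>The two component measures and their distribution functions\<close>

context
  fixes n :: nat and \<beta> :: real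
  assumes n: "n \<ge> 2" and \<beta>: "\<beta> > 1"
begin

lemma slope_gt_2: "real n * \<beta> > 2"
proof -
  have "2 * 1 < real n * \<beta>" using n \<beta> by (intro mult_le_less_imp_less) auto
  then show ?thesis by simp
qed

lemma slope_gt_1: "real n * \<beta> > 1"
  using slope_gt_2 by simp

lemma mu_comp_nat_real: "mu_comp (real n) \<beta> = parry (real n * \<beta>)"
  unfolding mu_comp_def Tmap_comp_Tmap by (rule acim_Tmap[OF slope_gt_1])

text \<open>The image of Parry's measure under \<open>Tmap \<beta>\<close> is one candidate. Any
  candidate \<open>\<nu>\<close> is carried by \<open>Tmap (real n)\<close> to Parry's measure, and
  a further \<open>Tmap \<beta>\<close> returns \<open>\<nu>\<close> by its invariance.\<close>

lemma mu_comp_real_nat: "mu_comp \<beta> (real n) = distr (parry (real n * \<beta>)) unit_leb (Tmap \<beta>)"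
  unfolding mu_comp_def
proof (rule acim_eqI)
  have \<mu>: "is_acim (Tmap (real n) \<circ> Tmap \<beta>) (parry (real n * \<beta>))"
    unfolding Tmap_comp_Tmap by (rule is_acim_parry[OF slope_gt_1])
  show "is_acim (Tmap \<beta> \<circ> Tmap (real n)) (distr (parry (real n * \<beta>)) unit_leb (Tmap \<beta>))"
    by (rule is_acim_comp_commute[OF \<mu> Tmap_measurable]) (use \<beta> in simp)
  fix \<nu> assume \<nu>: "is_acim (Tmap \<beta> \<circ> Tmap (real n)) \<nu>"
  have "is_acim (Tmap (real n) \<circ> Tmap \<beta>) (distr \<nu> unit_leb (Tmap (real n)))"
    by (rule is_acim_comp_commute[OF \<nu> Tmap_measurable]) (use n in simp)
  then have eq: "parry (real n * \<beta>) = distr \<nu> unit_leb (Tmap (real n))"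
    using \<mu> unfolding Tmap_comp_Tmap by (intro is_acim_Tmap_unique[OF _ _ slope_gt_1])
  have s: "sets \<nu> = sets unit_leb" and inv: "distr \<nu> \<nu> (Tmap \<beta> \<circ> Tmap (real n)) = \<nu>"
    using \<nu> by (simp_all only: is_acim_def)
  have m: "Tmap (real n) \<in> measurable \<nu> unit_leb"
    using Tmap_measurable s by (simp cong: measurable_cong_sets)
  have "distr (parry (real n * \<beta>)) unit_leb (Tmap \<beta>) = distr \<nu> unit_leb (Tmap \<beta> \<circ> Tmap (real n))"
    unfolding eq by (rule distr_distr[OF Tmap_measurable m])
  also have "\<dots> = distr \<nu> \<nu> (Tmap \<beta> \<circ> Tmap (real n))"
    by (rule distr_cong) (simp_all add: s)
  finally show "\<nu> = distr (parry (real n * \<beta>)) unit_leb (Tmap \<beta>)" by (simp only: inv)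
qed

lemma sets_mu_comp:
  "sets (mu_comp (real n) \<beta>) = sets unit_leb" "sets (mu_comp \<beta> (real n)) = sets unit_leb"
  by (simp_all add: mu_comp_nat_real mu_comp_real_nat sets_parry[OF slope_gt_1])

text \<open>\<open>measure_of\<close> takes over the prescribed set function once this is positive
  and countably additive on the sigma-algebra; both are checked on the two sections.\<close>

lemma emeasure_alt_mu:
  assumes S: "S \<in> sets (count_space {0::nat,1} \<Otimes>\<^sub>M unit_leb)"
  shows "emeasure (alt_mu \<beta> n) S = (1/2) * emeasure (mu_comp (real n) \<beta>) {x. (0,x) \<in> S}
         + (1/2) * emeasure (mu_comp \<beta> (real n)) {x. (1,x) \<in> S}"
proof -
  let ?M = "count_space {0::nat,1} \<Otimes>\<^sub>M unit_leb"
  let ?\<mu> = "mu_comp (real n) \<beta>" and ?\<nu> = "mu_comp \<beta> (real n)"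
  let ?F = "\<lambda>S. (1/2) * emeasure ?\<mu> {x. (0::nat,x) \<in> S} + (1/2) * emeasure ?\<nu> {x. (1,x) \<in> S}"
  have sp: "space ?M = {0,1} \<times> {0..<1}" by (simp add: space_pair_measure)
  have sec: "{x. (i, x) \<in> A} \<in> sets unit_leb" if "A \<in> sets ?M" for A and i :: nat
    using sets_Pair1[OF that, of i] by (simp add: vimage_def)
  have "countably_additive (sets ?M) ?F"
  proof (rule countably_additiveI)
    fix A :: "nat \<Rightarrow> (nat \<times> real) set"
    assume A: "range A \<subseteq> sets ?M" "disjoint_family A"
    have sA: "{x. (i, x) \<in> A j} \<in> sets unit_leb" for i j using A by (intro sec) auto
    have dA: "disjoint_family (\<lambda>j. {x. (i, x) \<in> A j})" for i
      using A(2) by (auto simp: disjoint_family_on_def)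
    have U: "{x. (i, x) \<in> (\<Union>j. A j)} = (\<Union>j. {x. (i, x) \<in> A j})" for i by auto
    have a: "(\<Sum>j. emeasure ?\<mu> {x. (0, x) \<in> A j}) = emeasure ?\<mu> {x. (0, x) \<in> (\<Union>j. A j)}"
      unfolding U by (rule suminf_emeasure) (use sA dA sets_mu_comp in auto)
    have b: "(\<Sum>j. emeasure ?\<nu> {x. (1, x) \<in> A j}) = emeasure ?\<nu> {x. (1, x) \<in> (\<Union>j. A j)}"
      unfolding U by (rule suminf_emeasure) (use sA dA sets_mu_comp in auto)
    have "(\<Sum>j. ?F (A j)) = (\<Sum>j. (1/2) * emeasure ?\<mu> {x. (0, x) \<in> A j})
        + (\<Sum>j. (1/2) * emeasure ?\<nu> {x. (1, x) \<in> A j})"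
      by (rule suminf_add[symmetric]) simp_all
    also have "\<dots> = ?F (\<Union>j. A j)"
      by (simp only: ennreal_suminf_cmult a b)
    finally show "(\<Sum>j. ?F (A j)) = ?F (\<Union>j. A j)" .
  qed
  moreover have "positive (sets ?M) ?F" by (simp add: positive_def)
  moreover have "sigma_algebra ({0,1} \<times> {0..<1}) (sets ?M)"
    using sets.sigma_algebra_axioms[of ?M] by (simp only: sp)
  ultimately show ?thesis
    unfolding alt_mu_def using S by (intro emeasure_measure_of_sigma)
qed

lemma emeasure_alt_mu_section:
  assumes "A \<in> sets unit_leb"
  shows "emeasure (alt_mu \<beta> n) ({0} \<times> A) = (1/2) * emeasure (mu_comp (real n) \<beta>) A"
    and "emeasure (alt_mu \<beta> n) ({1} \<times> A) = (1/2) * emeasure (mu_comp \<beta> (real n)) A"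
  using assms by (subst emeasure_alt_mu; simp)+

text \<open>The cut-off \<open>min a 1\<close> lets \<open>a\<close> run beyond 1, where the
  distribution function is constant. This makes the kink at 1, caused by the orbit point of index 0,
  visible.\<close>

lemma measure_mu_comp_nat_real:
  assumes "0 \<le> a"
  shows "measure (mu_comp (real n) \<beta>) {0..<min a 1}
    = (\<Sum>k. parry_const (real n * \<beta>) / (real n * \<beta>) ^ k * min a (orbit_one (real n * \<beta>) k))"
proof -
  let ?g = "real n * \<beta>"
  have A: "{0..<min a 1} \<in> sets unit_leb" by (auto simp: sets_unit_leb_iff)
  have "measure lborel ({0..<min a 1} \<inter> {0..<orbit_one ?g k}) = min a (orbit_one ?g k)" for k
    using assms orbit_one_bounds[of ?g k] by (simp add: min_def)
  then have "measure (mu_comp (real n) \<beta>) {0..<min a 1}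
      = parry_const ?g * (\<Sum>k. min a (orbit_one ?g k) / ?g ^ k)"
    unfolding mu_comp_nat_real measure_parry[OF slope_gt_1 A] by simp
  also have "\<dots> = (\<Sum>k. parry_const ?g * (min a (orbit_one ?g k) / ?g ^ k))"
    by (rule suminf_mult[symmetric], rule summable_weighted[OF slope_gt_1, of _ 1])
       (use assms orbit_one_bounds[of ?g] in \<open>auto simp: min_le_iff_disj\<close>)
  finally show ?thesis by (simp add: mult_ac)
qed

text \<open>Full branches of \<open>Tmap \<beta>\<close> spread mass uniformly and give the linear
  term, which has no kink. Each incomplete branch ends at the image of an orbit point and gives a
  \<open>min\<close> term.\<close>

lemma measure_mu_comp_real_nat:
  "\<exists>L. \<forall>a\<in>{0..1}. measure (mu_comp \<beta> (real n)) {0..<a} = L * a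
    + (\<Sum>k. parry_const (real n * \<beta>) / \<beta> / (real n * \<beta>) ^ k * min a (Tmap \<beta> (orbit_one (real n * \<beta>) k)))"
proof -
  let ?g = "real n * \<beta>"
  let ?t = "orbit_one ?g" and ?c = "parry_const ?g"
  have s1: "summable (\<lambda>k. of_int \<lfloor>\<beta> * ?t k\<rfloor> / ?g ^ k)"
  proof (rule summable_weighted[OF slope_gt_1, of _ \<beta>])
    fix k
    show "0 \<le> real_of_int \<lfloor>\<beta> * ?t k\<rfloor>" using orbit_one_bounds[of ?g k] \<beta> by simp
    have "\<beta> * ?t k \<le> \<beta>" using orbit_one_bounds[of ?g k] \<beta> by simp
    then show "real_of_int \<lfloor>\<beta> * ?t k\<rfloor> \<le> \<beta>" by linarith
  qed
  have "measure (mu_comp \<beta> (real n)) {0..<a} = (?c / \<beta> * (\<Sum>k. of_int \<lfloor>\<beta> * ?t k\<rfloor> / ?g ^ k)) * a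
    + (\<Sum>k. ?c / \<beta> / ?g ^ k * min a (Tmap \<beta> (?t k)))" if a: "a \<in> {0..1}" for a
  proof -
    have A: "{0..<a} \<in> sets unit_leb" using a by (auto simp: sets_unit_leb_iff)
    have pre: "{x\<in>{0..<1}. Tmap \<beta> x \<in> {0..<a}} \<in> sets unit_leb"
      using iter_preimage_sets[OF A, of "Tmap \<beta>" 1 1] by simp
    have mT: "Tmap \<beta> \<in> measurable (parry ?g) unit_leb"
      using Tmap_measurable sets_parry[OF slope_gt_1] by (simp cong: measurable_cong_sets)
    have s2: "summable (\<lambda>k. min a (Tmap \<beta> (?t k)) / ?g ^ k)"
      by (rule summable_weighted[OF slope_gt_1, of _ 1])
         (use a Tmap_range in \<open>auto simp: min_le_iff_disj\<close>)
    have "measure (mu_comp \<beta> (real n)) {0..<a} = measure (parry ?g) (Tmap \<beta> -` {0..<a} \<inter> space (parry ?g))"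
      unfolding mu_comp_real_nat by (rule measure_distr[OF mT A])
    also have "Tmap \<beta> -` {0..<a} \<inter> space (parry ?g) = {x\<in>{0..<1}. Tmap \<beta> x \<in> {0..<a}}"
      by (auto simp: parry_def)
    also have "measure (parry ?g) \<dots>
       = ?c * (\<Sum>k. measure lborel ({x\<in>{0..<1}. Tmap \<beta> x \<in> {0..<a}} \<inter> {0..<?t k}) / ?g ^ k)"
      by (rule measure_parry[OF slope_gt_1 pre])
    also have "(\<lambda>k. measure lborel ({x\<in>{0..<1}. Tmap \<beta> x \<in> {0..<a}} \<inter> {0..<?t k}) / ?g ^ k)
       = (\<lambda>k. (a * (of_int \<lfloor>\<beta> * ?t k\<rfloor> / ?g ^ k) + min a (Tmap \<beta> (?t k)) / ?g ^ k) / \<beta>)"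
    proof
      fix k
      have "{x\<in>{0..<1}. Tmap \<beta> x \<in> {0..<a}} \<inter> {0..<?t k} = {x\<in>{0..<?t k}. Tmap \<beta> x \<in> {0..<a}}"
        using orbit_one_bounds[of ?g k] by auto
      moreover have "measure lborel {0..<a} = a" using a by simp
      moreover have "measure lborel ({0..<a} \<inter> {0..<Tmap \<beta> (?t k)}) = min a (Tmap \<beta> (?t k))"
        using a Tmap_range[of \<beta> "?t k"] by (simp add: min_def)
      ultimately have "measure lborel ({x\<in>{0..<1}. Tmap \<beta> x \<in> {0..<a}} \<inter> {0..<?t k})
          = (of_int \<lfloor>\<beta> * ?t k\<rfloor> * a + min a (Tmap \<beta> (?t k))) / \<beta>"
        using measure_Tmap_preimage[OF A _ orbit_one_bounds(1)[of ?g k], of \<beta>] \<beta>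
        by (simp only:)
      then show "measure lborel ({x\<in>{0..<1}. Tmap \<beta> x \<in> {0..<a}} \<inter> {0..<?t k}) / ?g ^ k
          = (a * (of_int \<lfloor>\<beta> * ?t k\<rfloor> / ?g ^ k) + min a (Tmap \<beta> (?t k)) / ?g ^ k) / \<beta>"
        by (simp add: add_divide_distrib mult_ac)
    qed
    also have "(\<Sum>k. (a * (of_int \<lfloor>\<beta> * ?t k\<rfloor> / ?g ^ k) + min a (Tmap \<beta> (?t k)) / ?g ^ k) / \<beta>)
        = (a * (\<Sum>k. of_int \<lfloor>\<beta> * ?t k\<rfloor> / ?g ^ k) + (\<Sum>k. min a (Tmap \<beta> (?t k)) / ?g ^ k)) / \<beta>"
      by (intro sums_unique[symmetric] sums_divide sums_add sums_mult summable_sums s1 s2)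
    also have "?c * \<dots> = (?c / \<beta> * (\<Sum>k. of_int \<lfloor>\<beta> * ?t k\<rfloor> / ?g ^ k)) * a
        + ?c / \<beta> * (\<Sum>k. min a (Tmap \<beta> (?t k)) / ?g ^ k)"
      by (simp add: add_divide_distrib algebra_simps)
    also have "?c / \<beta> * (\<Sum>k. min a (Tmap \<beta> (?t k)) / ?g ^ k)
        = (\<Sum>k. ?c / \<beta> * (min a (Tmap \<beta> (?t k)) / ?g ^ k))"
      by (rule suminf_mult[symmetric, OF s2])
    also have "(\<lambda>k. ?c / \<beta> * (min a (Tmap \<beta> (?t k)) / ?g ^ k))
        = (\<lambda>k. ?c / \<beta> / ?g ^ k * min a (Tmap \<beta> (?t k)))" by simp
    finally show ?thesis .
  qed
  then show ?thesis by blast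
qed

end

section \<open>Jumps of the densities\<close>

text \<open>The symmetric second difference kills the linear term. On \<open>min a (t k)\<close>,
  divided by \<open>e\<close>, it is 1 if \<open>t k = p\<close> and vanishes once \<open>e\<close>
  is below the distance from \<open>t k\<close> to \<open>p\<close>. The weights dominate, so
  Tannery's theorem exchanges limit and sum.\<close>

lemma kink_limit:
  fixes w t :: "nat \<Rightarrow> real" and L p :: real
  assumes w: "summable w" "\<And>k. 0 \<le> w k" and t: "\<And>k. 0 \<le> t k" "\<And>k. t k \<le> 1" and p: "p > 0"
  defines "\<Phi> \<equiv> \<lambda>a. L * a + (\<Sum>k. w k * min a (t k))"
  shows "((\<lambda>e. (2 * \<Phi> p - \<Phi> (p + e) - \<Phi> (p - e)) / e) \<longlongrightarrow> (\<Sum>k. w k * of_bool (t k = p))) (at_right 0)"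
proof -
  let ?d = "\<lambda>k e. w k * ((2 * min p (t k) - min (p + e) (t k) - min (p - e) (t k)) / e)"
  have small: "\<forall>\<^sub>F e in at_right 0. 0 < e \<and> e < p"
    using p by (intro eventually_at_rightI[of 0 p]) auto
  have lim: "(?d k \<longlongrightarrow> w k * of_bool (t k = p)) (at_right 0)" for k
  proof (cases "t k = p")
    case True
    have "\<forall>\<^sub>F e in at_right 0. w k * of_bool (t k = p) = ?d k e"
      using small by eventually_elim (simp add: True)
    then show ?thesis by (rule Lim_transform_eventually[OF tendsto_const])
  next
    case False
    then have "\<forall>\<^sub>F e in at_right 0. 0 < e \<and> e < \<bar>t k - p\<bar>"
      by (intro eventually_at_rightI[of 0 "\<bar>t k - p\<bar>"]) auto
    then have "\<forall>\<^sub>F e in at_right 0. w k * of_bool (t k = p) = ?d k e"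
    proof eventually_elim
      case (elim e)
      show ?case
      proof (cases "t k < p")
        case True
        with elim have "min p (t k) = t k" "min (p + e) (t k) = t k" "min (p - e) (t k) = t k"
          by linarith+
        then show ?thesis using False by simp
      next
        case ge: False
        with elim False have "min p (t k) = p" "min (p + e) (t k) = p + e" "min (p - e) (t k) = p - e"
          by linarith+
        then show ?thesis using False by simp
      qed
    qed
    then show ?thesis by (rule Lim_transform_eventually[OF tendsto_const])
  qed
  have bound: "norm (?d k e) \<le> w k" if e: "e > 0" for k e
  proof -
    \<comment> \<open>\<open>min\<close> has only the slopes 1 and 0, so the second difference lies
      between 0 and \<open>e\<close>.\<close>
    have "\<bar>2 * min p (t k) - min (p + e) (t k) - min (p - e) (t k)\<bar> \<le> e"
      using e by linarith
    then have "\<bar>(2 * min p (t k) - min (p + e) (t k) - min (p - e) (t k)) / e\<bar> \<le> 1"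
      using e by (simp add: abs_divide)
    from mult_left_mono[OF this w(2)[of k]] show ?thesis
      using w(2)[of k] by (simp only: abs_mult real_norm_def abs_of_nonneg mult_1_right)
  qed
  have pos: "\<forall>\<^sub>F e in at_right 0. (0::real) < e"
    by (rule eventually_at_right_less)
  have "\<forall>\<^sub>F (k, e) in sequentially \<times>\<^sub>F at_right 0. norm (?d k e) \<le> w k"
    unfolding case_prod_unfold
  proof (rule eventually_mono)
    show "\<forall>\<^sub>F ke in sequentially \<times>\<^sub>F at_right 0. (0::real) < snd ke"
      using eventually_prodI[OF always_eventually[of "\<lambda>_. True"] pos] by simp
  qed (rule bound)
  from tannerys_theorem[OF lim this w(1) trivial_limit_at_right_real]
  have "((\<lambda>e. \<Sum>k. ?d k e) \<longlongrightarrow> (\<Sum>k. w k * of_bool (t k = p))) (at_right 0)"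
    by (elim conjE)
  moreover have "\<forall>\<^sub>F e in at_right 0. (\<Sum>k. ?d k e) = (2 * \<Phi> p - \<Phi> (p + e) - \<Phi> (p - e)) / e"
    using small
  proof eventually_elim
    case (elim e)
    have s: "summable (\<lambda>k. w k * min a (t k))" if "a > 0" for a
    proof (rule summable_comparison_test'[OF w(1)])
      show "norm (w k * min a (t k)) \<le> w k" for k
      proof -
        have "0 \<le> min a (t k)" "min a (t k) \<le> 1" using that t[of k] by auto
        from mult_left_mono[OF this(2) w(2)[of k]] this(1) show ?thesis
          using w(2)[of k] by (simp add: abs_mult)
      qed
    qed
    let ?S = "\<lambda>a. \<Sum>k. w k * min a (t k)"
    have "(\<lambda>k. (2 * (w k * min p (t k)) - w k * min (p + e) (t k) - w k * min (p - e) (t k)) / e)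
       sums ((2 * ?S p - ?S (p + e) - ?S (p - e)) / e)"
    proof -
      have "0 < p + e" "0 < p - e" using elim p by auto
      then show ?thesis
        using p by (intro sums_divide sums_diff sums_mult summable_sums s)
    qed
    moreover have "(\<lambda>k. (2 * (w k * min p (t k)) - w k * min (p + e) (t k) - w k * min (p - e) (t k)) / e)
        = (\<lambda>k. ?d k e)"
    proof
      have "(2 * (c * x) - c * y - c * z) / e = c * ((2 * x - y - z) / e)" for c x y z
        by (simp add: algebra_simps)
      then show "(2 * (w k * min p (t k)) - w k * min (p + e) (t k) - w k * min (p - e) (t k)) / e
          = ?d k e" for k by (simp only:)
    qed
    moreover have "(2 * ?S p - ?S (p + e) - ?S (p - e)) / e = (2 * \<Phi> p - \<Phi> (p + e) - \<Phi> (p - e)) / e"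
      unfolding \<Phi>_def by (rule arg_cong[of _ _ "\<lambda>x. x / e"]) (simp add: algebra_simps)
    ultimately show ?case by (simp only: sums_iff)
  qed
  ultimately show ?thesis by (rule Lim_transform_eventually)
qed

text \<open>As \<open>p\<close> lies strictly between 0 and \<open>b\<close>, for small
  \<open>e\<close> all three arguments of the second difference stay where the functions
  agree.\<close>

lemma kinks_eq:
  fixes w t w' t' :: "nat \<Rightarrow> real"
  assumes w: "summable w" "\<And>k. 0 \<le> w k" and t: "\<And>k. 0 \<le> t k" "\<And>k. t k \<le> 1"
    and w': "summable w'" "\<And>k. 0 \<le> w' k" and t': "\<And>k. 0 \<le> t' k" "\<And>k. t' k \<le> 1"
    and eq: "\<And>a. 0 \<le> a \<Longrightarrow> a \<le> b \<Longrightarrow>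
      L * a + (\<Sum>k. w k * min a (t k)) = L' * a + (\<Sum>k. w' k * min a (t' k))"
    and p: "0 < p" "p < b"
  shows "(\<Sum>k. w k * of_bool (t k = p)) = (\<Sum>k. w' k * of_bool (t' k = p))"
proof -
  let ?F = "\<lambda>a. L * a + (\<Sum>k. w k * min a (t k))" and ?G = "\<lambda>a. L' * a + (\<Sum>k. w' k * min a (t' k))"
  have "\<forall>\<^sub>F e in at_right 0. e < min p (b - p) \<and> 0 < e"
    using p by (intro eventually_at_rightI[of 0 "min p (b - p)"]) auto
  then have "\<forall>\<^sub>F e in at_right 0. (2 * ?F p - ?F (p + e) - ?F (p - e)) / e = (2 * ?G p - ?G (p + e) - ?G (p - e)) / e"
  proof eventually_elim
    case (elim e)
    then show ?case using eq[of p] eq[of "p + e"] eq[of "p - e"] p by simp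
  qed
  from Lim_transform_eventually[OF kink_limit[OF w t p(1)] this]
  show ?thesis
    by (rule tendsto_unique[OF _ _ kink_limit[OF w' t' p(1)], rotated]) simp
qed

section \<open>Dominant jumps for slopes above 2\<close>

text \<open>The drop at \<open>p\<close> of the slope of the concave function \<open>a \<mapsto> \<Sum>\<^sub>k C g\<^sup>-\<^sup>k min a (t k)\<close>.\<close>

definition kink :: "real \<Rightarrow> real \<Rightarrow> (nat \<Rightarrow> real) \<Rightarrow> real \<Rightarrow> real" where
  "kink C g t p = (\<Sum>k. C / g ^ k * of_bool (t k = p))"

context
  fixes C g :: real
  assumes C: "C > 0" and g: "g > 2"
begin

lemma kink_weight_summable: "summable (\<lambda>k. C / g ^ k)"
  using summable_mult[OF summable_geometric_weight[of g], of C] g by simp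

lemma kink_summable: "summable (\<lambda>k. C / g ^ k * of_bool (t k = p))"
  by (rule summable_comparison_test'[OF kink_weight_summable]) (use C g in auto)

lemma kink_ge:
  assumes "t j = p"
  shows "C / g ^ j \<le> kink C g t p"
  using sum_le_suminf[OF kink_summable, of "{j}" t p] assms C g by (simp add: kink_def)

lemma kink_single:
  assumes "\<And>k. t k = p \<longleftrightarrow> k = j"
  shows "kink C g t p = C / g ^ j"
proof -
  have "(\<lambda>k. C / g ^ k * of_bool (t k = p)) = (\<lambda>k. if k = j then C / g ^ k else 0)"
    using assms by auto
  then show ?thesis unfolding kink_def using sums_single[of j "\<lambda>k. C / g ^ k"] by (simp add: sums_iff)
qed

text \<open>A slope above 2 makes each weight exceed the sum of all later ones.\<close>

lemma kink_less:
  assumes "\<And>k. k \<le> j \<Longrightarrow> t k \<noteq> p"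
  shows "kink C g t p < C / g ^ j"
proof -
  have "kink C g t p = (\<Sum>k. C / g ^ (k + Suc j) * of_bool (t (k + Suc j) = p))"
    unfolding kink_def using assms
    by (subst suminf_split_initial_segment[OF kink_summable, of _ _ "Suc j"]) simp
  also have "\<dots> \<le> (\<Sum>k. C / g ^ (k + Suc j))"
  proof (rule suminf_le)
    show "summable (\<lambda>k. C / g ^ (k + Suc j) * of_bool (t (k + Suc j) = p))"
      by (rule summable_ignore_initial_segment[OF kink_summable])
    show "summable (\<lambda>k. C / g ^ (k + Suc j))"
      by (rule summable_ignore_initial_segment[OF kink_weight_summable])
    show "C / g ^ (k + Suc j) * of_bool (t (k + Suc j) = p) \<le> C / g ^ (k + Suc j)" for k
      using C g by (cases "t (k + Suc j) = p") auto
  qed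
  also have "(\<lambda>k. C / g ^ (k + Suc j)) = (\<lambda>k. C / g ^ Suc j * (1 / g) ^ k)"
    by (simp add: power_add power_one_over field_simps)
  also have "(\<Sum>k. C / g ^ Suc j * (1 / g) ^ k) = C / g ^ Suc j * (1 / (1 - 1 / g))"
    using g by (subst suminf_mult) (auto simp: suminf_geometric summable_geometric)
  also have "\<dots> = C / g ^ j / (g - 1)" using g by (simp add: field_simps)
  also have "\<dots> < C / g ^ j / 1"
    using C g by (intro divide_strict_left_mono) auto
  finally show ?thesis by simp
qed

end

text \<open>If the points differed, each would receive from the other family only weights of index
  above \<open>j\<close>, which together stay below that family's weight at \<open>j\<close>. Each
  of the two weights at \<open>j\<close> would then be strictly smaller than the other.\<close>

lemma kink_leading:
  assumes C: "C > 0" "C' > 0" and g: "g > 2" "g' > 2"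
    and j: "\<And>k. k < j \<Longrightarrow> t k \<noteq> t' j" "\<And>k. k < j \<Longrightarrow> t' k \<noteq> t j"
    and eq: "kink C g t (t j) = kink C' g' t' (t j)" "kink C g t (t' j) = kink C' g' t' (t' j)"
  shows "t j = t' j"
proof (rule ccontr)
  assume ne: "t j \<noteq> t' j"
  have "C / g ^ j \<le> kink C g t (t j)" by (rule kink_ge[OF C(1) g(1)]) simp
  also have "\<dots> = kink C' g' t' (t j)" by (rule eq(1))
  also have "\<dots> < C' / g' ^ j"
    by (rule kink_less[OF C(2) g(2)]) (use j(2) ne in \<open>metis le_neq_implies_less\<close>)
  also have "\<dots> \<le> kink C' g' t' (t' j)" by (rule kink_ge[OF C(2) g(2)]) simp
  also have "\<dots> = kink C g t (t' j)" by (rule eq(2)[symmetric])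
  also have "\<dots> < C / g ^ j"
    by (rule kink_less[OF C(1) g(1)]) (use j(1) ne in \<open>metis le_neq_implies_less\<close>)
  finally show False .
qed

section \<open>Jumps along the orbit of 1\<close>

lemma orbit_one_Suc_zero:
  assumes "orbit_one g 1 = 0"
  shows "orbit_one g (Suc k) = 0"
  using assms by (induction k) (simp_all add: orbit_one_Suc Tmap_def)

lemma orbit_one_less_1: "orbit_one g (Suc k) < 1"
  by (simp add: orbit_one_Suc Tmap_range)

text \<open>This is the case of an integer slope: the orbit 1, 0, 0, ... leaves no jump in the
  interior.\<close>

lemma kink_zero_orbit:
  assumes "orbit_one g 1 = 0" "0 < p" "p < 1"
  shows "kink C g (orbit_one g) p = 0"
proof -
  have "orbit_one g k \<noteq> p" for k
    using assms orbit_one_Suc_zero[of g] by (cases k) auto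
  then show ?thesis by (simp add: kink_def)
qed

text \<open>Interior jumps do not see the orbit point 1 of index 0, so index 1 leads. The value 0 at
  index 1 is recognised by the absence of all interior jumps.\<close>

lemma orbit_one_1_eq:
  assumes C: "C > 0" "C' > 0" and g: "g > 2" "g' > 2"
    and eq: "\<And>p. 0 < p \<Longrightarrow> p < 1 \<Longrightarrow> kink C g (orbit_one g) p = kink C' g' (orbit_one g') p"
  shows "orbit_one g 1 = orbit_one g' 1"
proof -
  have b: "0 \<le> orbit_one h 1" "orbit_one h 1 < 1" for h
    using orbit_one_bounds(1)[of h 1] orbit_one_less_1[of h 0] by simp_all
  have pos: "0 < kink D h (orbit_one h) (orbit_one h 1)" if "D > 0" "h > 2" for D h
  proof -
    have "0 < D / h ^ 1" using that by simp
    also have "\<dots> \<le> kink D h (orbit_one h) (orbit_one h 1)" by (rule kink_ge[OF that refl])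
    finally show ?thesis .
  qed
  consider "orbit_one g 1 = 0" "orbit_one g' 1 = 0" | "orbit_one g 1 = 0" "0 < orbit_one g' 1"
    | "0 < orbit_one g 1" "orbit_one g' 1 = 0" | "0 < orbit_one g 1" "0 < orbit_one g' 1"
    using order_le_imp_less_or_eq[OF b(1)[of g]] order_le_imp_less_or_eq[OF b(1)[of g']] by metis
  then show ?thesis
  proof cases
    case 1
    then show ?thesis by simp
  next
    case 2
    then show ?thesis
      using pos[OF C(2) g(2)] kink_zero_orbit[OF 2 b(2), of C] eq[OF 2(2) b(2)] by linarith
  next
    case 3
    then show ?thesis
      using pos[OF C(1) g(1)] kink_zero_orbit[OF 3(2,1) b(2), of C'] eq[OF 3(1) b(2)] by linarith
  next
    case 4
    show ?thesis
    proof (rule kink_leading[OF C g])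
      show "orbit_one g k \<noteq> orbit_one g' 1" "orbit_one g' k \<noteq> orbit_one g 1" if "k < 1" for k
        using that b(2)[of g] b(2)[of g'] by simp_all
      show "kink C g (orbit_one g) (orbit_one g 1) = kink C' g' (orbit_one g') (orbit_one g 1)"
        by (rule eq[OF 4(1) b(2)])
      show "kink C g (orbit_one g) (orbit_one g' 1) = kink C' g' (orbit_one g') (orbit_one g' 1)"
        by (rule eq[OF 4(2) b(2)])
    qed
  qed
qed

text \<open>For \<open>g = p / q\<close> in lowest terms, \<open>q ^ k * orbit_one g k\<close> stays
  an integer prime to \<open>q\<close>, since a step multiplies it by \<open>p\<close> and subtracts
  a multiple of \<open>q\<close>. As \<open>q\<close> exceeds 1, the reduced denominators
  \<open>q ^ k\<close> are all distinct.\<close>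

lemma orbit_one_no_return:
  assumes g: "g \<in> \<rat>" "g \<notin> \<int>" and k: "orbit_one g k = orbit_one g 1"
  shows "k = 1"
proof -
  obtain p q :: int where q: "q > 0" "coprime p q" "g = of_int p / of_int q"
    using g(1) by (auto elim: Rats_cases')
  have "\<exists>z. of_int q ^ k * orbit_one g k = of_int z \<and> coprime z q" for k
  proof (induction k)
    case 0
    show ?case by (intro exI[of _ 1]) simp
  next
    case (Suc k)
    then obtain z where z: "of_int q ^ k * orbit_one g k = of_int z" "coprime z q" by blast
    let ?f = "\<lfloor>g * orbit_one g k\<rfloor>"
    have "of_int q ^ Suc k * orbit_one g (Suc k)
        = (of_int q * g) * (of_int q ^ k * orbit_one g k) - of_int q ^ Suc k * of_int ?f"
      by (simp add: orbit_one_Suc Tmap_def frac_def algebra_simps)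
    also have "of_int q * g = of_int p" using q by simp
    also have "of_int p * (of_int q ^ k * orbit_one g k) - of_int q ^ Suc k * of_int ?f
        = of_int (p * z - q ^ k * ?f * q)"
      unfolding z(1) by simp
    finally have "of_int q ^ Suc k * orbit_one g (Suc k) = of_int (p * z - q ^ k * ?f * q)" .
    moreover have "coprime (p * z - q ^ k * ?f * q) q"
    proof -
      have "coprime (p * z) q" using q z by simp
      show ?thesis
      proof (rule coprimeI)
        fix c assume c: "c dvd p * z - q ^ k * ?f * q" "c dvd q"
        have "c dvd (p * z - q ^ k * ?f * q) + q ^ k * ?f * q"
          by (rule dvd_add[OF c(1) dvd_mult[OF c(2)]])
        then have "c dvd p * z" by simp
        then show "is_unit c"
          by (rule coprime_common_divisor[OF \<open>coprime (p * z) q\<close> _ c(2)])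
      qed
    qed
    ultimately show ?case by blast
  qed
  then obtain a b where a: "of_int q ^ k * orbit_one g k = of_int a" "coprime a q"
    and b: "of_int q ^ 1 * orbit_one g 1 = of_int b" by blast
  have "k \<noteq> 0" using k orbit_one_less_1[of g 0] by (metis One_nat_def less_irrefl orbit_one_0)
  \<comment> \<open>A return at time \<open>k \<ge> 2\<close> would put the factor
    \<open>q ^ (k - 1)\<close> into \<open>a\<close>, which is prime to \<open>q\<close>; then
    \<open>q = 1\<close> and \<open>g\<close> would be an integer.\<close>
  moreover have "\<not> k \<ge> 2"
  proof
    assume "k \<ge> 2"
    then obtain i where i: "k = Suc (Suc i)" by (metis add_2_eq_Suc le_Suc_ex)
    have "real_of_int a = of_int q ^ Suc i * (of_int q ^ 1 * orbit_one g 1)"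
      unfolding a(1)[symmetric] k unfolding i by simp
    also have "\<dots> = of_int (q ^ Suc i * b)" by (simp only: b of_int_mult of_int_power)
    finally have "a = q ^ Suc i * b" by (simp only: of_int_eq_iff)
    then have "q dvd a" by simp
    then have "q dvd 1" using a(2) by (metis coprime_common_divisor dvd_refl)
    then have "q = 1" using q(1) by simp
    then show False using q(3) g(2) by simp
  qed
  ultimately show ?thesis by linarith
qed

section \<open>Consequences of equal measures\<close>

lemma alt_mu_eq_imp_mu_comp_eq:
  assumes n: "n \<ge> 2" "\<beta> > 1" and m: "m \<ge> 2" "\<beta>' > 1"
    and eq: "alt_mu \<beta> n = alt_mu \<beta>' m" and A: "A \<in> sets unit_leb"
  shows "measure (mu_comp (real n) \<beta>) A = measure (mu_comp (real m) \<beta>') A"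
    and "measure (mu_comp \<beta> (real n)) A = measure (mu_comp \<beta>' (real m)) A"
proof -
  \<comment> \<open>Cancelling by multiplication with 2 covers infinite values in
    \<open>ennreal\<close> as well.\<close>
  have half: "x = y" if "(1/2) * x = (1/2) * y" for x y :: ennreal
  proof -
    have "(1/2) * 2 = (1 :: ennreal)" by (simp add: ennreal_divide_times)
    then have unit: "2 * (1/2) = (1 :: ennreal)" by (simp only: mult.commute)
    from that have "2 * ((1/2) * x) = 2 * ((1/2) * y)" by (rule arg_cong)
    then show ?thesis unfolding mult.assoc[symmetric] unit mult_1_left .
  qed
  have "(1/2) * emeasure (mu_comp (real n) \<beta>) A = (1/2) * emeasure (mu_comp (real m) \<beta>') A"
    using emeasure_alt_mu_section(1)[OF n A] emeasure_alt_mu_section(1)[OF m A] eq by (simp only:)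
  from half[OF this] show "measure (mu_comp (real n) \<beta>) A = measure (mu_comp (real m) \<beta>') A"
    by (simp only: measure_def)
  have "(1/2) * emeasure (mu_comp \<beta> (real n)) A = (1/2) * emeasure (mu_comp \<beta>' (real m)) A"
    using emeasure_alt_mu_section(2)[OF n A] emeasure_alt_mu_section(2)[OF m A] eq by (simp only:)
  from half[OF this] show "measure (mu_comp \<beta> (real n)) A = measure (mu_comp \<beta>' (real m)) A"
    by (simp only: measure_def)
qed

text \<open>The first range of \<open>p\<close> includes 1, where the jump reveals the normalising
  constant. The second stays inside, because the distribution function used there is known only up
  to 1.\<close>

lemma mu_comp_kinks_eq:
  assumes n: "n \<ge> 2" "\<beta> > 1" and m: "m \<ge> 2" "\<beta>' > 1"
    and eq: "alt_mu \<beta> n = alt_mu \<beta>' m"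
  defines "g \<equiv> real n * \<beta>" and "g' \<equiv> real m * \<beta>'"
  shows "0 < p \<Longrightarrow> p \<le> 1 \<Longrightarrow>
      kink (parry_const g) g (orbit_one g) p = kink (parry_const g') g' (orbit_one g') p"
    and "0 < p \<Longrightarrow> p < 1 \<Longrightarrow>
      kink (parry_const g / \<beta>) g (\<lambda>k. Tmap \<beta> (orbit_one g k)) p
      = kink (parry_const g' / \<beta>') g' (\<lambda>k. Tmap \<beta>' (orbit_one g' k)) p"
proof -
  have g: "g > 2" "g' > 2" using slope_gt_2[OF n] slope_gt_2[OF m] by (simp_all only: g_def g'_def)
  have C: "parry_const g > 0" "parry_const g' > 0"
    using parry_const_pos g by simp_all
  have D: "parry_const g / \<beta> > 0" "parry_const g' / \<beta>' > 0"
    using C n(2) m(2) by simp_all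
  have w: "0 \<le> E / h ^ k" if "E > 0" "h > 2" for E h :: real and k using that by simp
  show "kink (parry_const g) g (orbit_one g) p = kink (parry_const g') g' (orbit_one g') p"
    if p: "0 < p" "p \<le> 1"
    unfolding kink_def
  \<comment> \<open>\<open>b = 2\<close> leaves room to the right of \<open>p = 1\<close>.\<close>
  proof (rule kinks_eq[where L = 0 and L' = 0 and b = 2])
    fix a :: real assume a: "0 \<le> a" "a \<le> 2"
    have "{0..<min a 1} \<in> sets unit_leb" by (auto simp: sets_unit_leb_iff)
    from alt_mu_eq_imp_mu_comp_eq(1)[OF n m eq this]
    show "0 * a + (\<Sum>k. parry_const g / g ^ k * min a (orbit_one g k))
        = 0 * a + (\<Sum>k. parry_const g' / g' ^ k * min a (orbit_one g' k))"
      unfolding measure_mu_comp_nat_real[OF n a(1)] measure_mu_comp_nat_real[OF m a(1)]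
        g_def g'_def by (simp only: mult_zero_left)
  qed (use p in \<open>simp_all add: kink_weight_summable C g w orbit_one_bounds\<close>)
  obtain L L' where
    L: "\<And>a. a \<in> {0..1} \<Longrightarrow> measure (mu_comp \<beta> (real n)) {0..<a}
      = L * a + (\<Sum>k. parry_const g / \<beta> / g ^ k * min a (Tmap \<beta> (orbit_one g k)))"
    and L': "\<And>a. a \<in> {0..1} \<Longrightarrow> measure (mu_comp \<beta>' (real m)) {0..<a}
      = L' * a + (\<Sum>k. parry_const g' / \<beta>' / g' ^ k * min a (Tmap \<beta>' (orbit_one g' k)))"
    using measure_mu_comp_real_nat[OF n] measure_mu_comp_real_nat[OF m]
    unfolding g_def g'_def by blast
  show "kink (parry_const g / \<beta>) g (\<lambda>k. Tmap \<beta> (orbit_one g k)) p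
      = kink (parry_const g' / \<beta>') g' (\<lambda>k. Tmap \<beta>' (orbit_one g' k)) p"
    if p: "0 < p" "p < 1"
    unfolding kink_def
  \<comment> \<open>The linear coefficients are not known to agree; comparing kinks is insensitive
    to them.\<close>
  proof (rule kinks_eq[where L = L and L' = L' and b = 1])
    fix a :: real assume a: "0 \<le> a" "a \<le> 1"
    then have a': "a \<in> {0..1}" by simp
    have "{0..<a} \<in> sets unit_leb" using a by (auto simp: sets_unit_leb_iff)
    from alt_mu_eq_imp_mu_comp_eq(2)[OF n m eq this]
    show "L * a + (\<Sum>k. parry_const g / \<beta> / g ^ k * min a (Tmap \<beta> (orbit_one g k)))
        = L' * a + (\<Sum>k. parry_const g' / \<beta>' / g' ^ k * min a (Tmap \<beta>' (orbit_one g' k)))"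
      unfolding L[OF a'] L'[OF a'] .
  next
    show "summable (\<lambda>k. parry_const g / \<beta> / g ^ k)" "summable (\<lambda>k. parry_const g' / \<beta>' / g' ^ k)"
      by (rule kink_weight_summable[OF D(1) g(1)] kink_weight_summable[OF D(2) g(2)])+
    show "0 \<le> parry_const g / \<beta> / g ^ k" "0 \<le> parry_const g' / \<beta>' / g' ^ k" for k
      by (rule w[OF D(1) g(1)] w[OF D(2) g(2)])+
  qed (use p Tmap_range in \<open>auto intro: less_imp_le\<close>)
qed

lemma frac_eq_imp_diff_Ints:
  fixes x y :: real
  assumes "frac x = frac y"
  shows "x - y \<in> \<int>"
proof -
  have "x - y = of_int (\<lfloor>x\<rfloor> - \<lfloor>y\<rfloor>)" using assms by (simp add: frac_def)
  then show ?thesis by (simp only: Ints_of_int)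
qed

text \<open>Bezout writes 1 as an integer combination of \<open>m\<close> and \<open>n\<close>, and
  thereby \<open>\<beta>\<close> as one of two integers.\<close>

lemma coprime_mult_Ints:
  fixes \<beta> :: real
  assumes "coprime m n" "real m * \<beta> \<in> \<int>" "real n * \<beta> \<in> \<int>"
  shows "\<beta> \<in> \<int>"
proof -
  obtain u v :: int where uv: "u * int m + v * int n = 1"
    using assms(1) bezout_int[of "int m" "int n"] by auto
  have "\<beta> = of_int (u * int m + v * int n) * \<beta>" unfolding uv by simp
  also have "\<dots> = of_int u * (real m * \<beta>) + of_int v * (real n * \<beta>)"
    by (simp add: algebra_simps)
  also have "\<dots> \<in> \<int>" using assms by (intro Ints_add Ints_mult[OF Ints_of_int])
  finally show ?thesis .
qed

lemma orbit_one_1: "orbit_one g 1 = frac g"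
  by (simp add: orbit_one_def Tmap_def)

lemma kink_orbit_one_at_1:
  assumes "C > 0" "g > 2"
  shows "kink C g (orbit_one g) 1 = C"
proof -
  have "orbit_one g k = 1 \<longleftrightarrow> k = 0" for k
    using orbit_one_less_1[of g] by (cases k) (simp, metis less_irrefl nat.distinct(1))
  from kink_single[OF assms this] show ?thesis by simp
qed

text \<open>Applying \<open>Tmap (real n)\<close> turns such a coincidence into a return of the
  orbit of 1, at time \<open>Suc k\<close>, to its value at time 1.\<close>

lemma orbit_one_image_no_return:
  assumes g: "real n * \<beta> \<in> \<rat>" "real n * \<beta> \<notin> \<int>"
  shows "Tmap \<beta> (orbit_one (real n * \<beta>) k) = Tmap \<beta> 1 \<longleftrightarrow> k = 0"
proof
  let ?g = "real n * \<beta>"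
  assume "Tmap \<beta> (orbit_one ?g k) = Tmap \<beta> 1"
  then have "(Tmap (real n) \<circ> Tmap \<beta>) (orbit_one ?g k) = (Tmap (real n) \<circ> Tmap \<beta>) (orbit_one ?g 0)"
    by simp
  then have "orbit_one ?g (Suc k) = orbit_one ?g 1"
    unfolding Tmap_comp_Tmap One_nat_def orbit_one_Suc .
  from orbit_one_no_return[OF g this] show "k = 0" by simp
qed simp

theorem theorem3p7:
  fixes m n :: nat and \<beta> \<beta>' :: real
  assumes "m \<ge> 2" and "n \<ge> 2" and "coprime m n"
    and "\<beta> > 1" and "\<beta>' > 1" and "\<beta> \<notin> \<int>" and "\<beta>' \<notin> \<int>"
  shows "alt_mu \<beta> n \<noteq> alt_mu \<beta>' m"
proof
  assume eq: "alt_mu \<beta> n = alt_mu \<beta>' m"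
  define g g' where g_def: "g = real n * \<beta>" and g'_def: "g' = real m * \<beta>'"
  let ?c = "parry_const g" and ?c' = "parry_const g'"
  let ?s = "\<lambda>k. Tmap \<beta> (orbit_one g k)" and ?s' = "\<lambda>k. Tmap \<beta>' (orbit_one g' k)"
  note n = \<open>n \<ge> 2\<close> \<open>\<beta> > 1\<close> and m = \<open>m \<ge> 2\<close> \<open>\<beta>' > 1\<close>
  have g: "g > 2" "g' > 2" using slope_gt_2[OF n] slope_gt_2[OF m] by (simp_all only: g_def g'_def)
  have C: "?c > 0" "?c' > 0" using parry_const_pos g by simp_all
  have D: "?c / \<beta> > 0" "?c' / \<beta>' > 0" using C n(2) m(2) by simp_all
  note kinks = mu_comp_kinks_eq[OF n m eq, folded g_def g'_def]
  have frac_g: "frac g = frac g'"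
    unfolding orbit_one_1[symmetric]
    by (rule orbit_one_1_eq[OF C g]) (rule kinks(1), simp_all)
  have s0: "?s 0 = frac \<beta>" "?s' 0 = frac \<beta>'" by (simp_all add: Tmap_def)
  have frac_\<beta>: "0 < frac \<beta>" "frac \<beta> < 1" "0 < frac \<beta>'" "frac \<beta>' < 1"
    using \<open>\<beta> \<notin> \<int>\<close> \<open>\<beta>' \<notin> \<int>\<close> by (simp_all add: frac_lt_1 frac_gt_0_iff)
  \<comment> \<open>Both bases are non-integral, so the points of index 0 already lie inside (0, 1)
    and index 0 leads here.\<close>
  have "?s 0 = ?s' 0"
    by (rule kink_leading[OF D g]) (unfold s0, simp, simp, (rule kinks(2); fact frac_\<beta>)+)
  then have frac_eq: "frac \<beta> = frac \<beta>'" by (simp only: s0)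
  have "n \<noteq> m" using \<open>coprime m n\<close> n(1) by auto
  have int: "(real n - real m) * \<beta> \<in> \<int>"
  proof -
    \<comment> \<open>Subtracting \<open>m\<close> times the integer
      \<open>\<beta> - \<beta>'\<close> from the integer \<open>g - g'\<close> eliminates
      \<open>\<beta>'\<close>.\<close>
    have "g - g' - real m * (\<beta> - \<beta>') \<in> \<int>"
      by (rule Ints_diff[OF frac_eq_imp_diff_Ints[OF frac_g]
            Ints_mult[OF Ints_of_nat frac_eq_imp_diff_Ints[OF frac_eq]]])
    also have "g - g' - real m * (\<beta> - \<beta>') = (real n - real m) * \<beta>"
      by (simp add: g_def g'_def algebra_simps)
    finally show ?thesis .
  qed
  show False
  proof (cases "g \<in> \<int>")
    case True
    have "g - (real n - real m) * \<beta> \<in> \<int>" using True int by (rule Ints_diff)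
    then have "real m * \<beta> \<in> \<int>" by (simp add: g_def algebra_simps)
    then have "\<beta> \<in> \<int>"
      using coprime_mult_Ints[OF \<open>coprime m n\<close>] True by (simp only: g_def)
    then show False using \<open>\<beta> \<notin> \<int>\<close> by simp
  next
    case g_int: False
    have "\<beta> = ((real n - real m) * \<beta>) / (real n - real m)" using \<open>n \<noteq> m\<close> by simp
    also have "\<dots> \<in> \<rat>"
      using int Ints_subset_Rats by (intro Rats_divide Rats_diff Rats_of_nat) blast
    finally have "\<beta> \<in> \<rat>" .
    then have g_rat: "g \<in> \<rat>" unfolding g_def by (intro Rats_mult Rats_of_nat)
    have "g' - g \<in> \<int>" using frac_eq_imp_diff_Ints[OF frac_g[symmetric]] .
    then have g'_rat: "g' \<in> \<rat>" and g'_int: "g' \<notin> \<int>"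
      using Rats_add[OF g_rat, of "g' - g"] Ints_subset_Rats g_int Ints_diff[of g' "g' - g"] by auto
    \<comment> \<open>At 1 only the term of index 0 jumps, so the jump there is the normalising
      constant itself.\<close>
    have c: "?c = ?c'"
      using kinks(1)[of 1] kink_orbit_one_at_1[OF C(1) g(1)] kink_orbit_one_at_1[OF C(2) g(2)] by simp
    let ?p = "frac g"
    have p: "0 < ?p" "?p < 1" using g_int by (simp_all add: frac_lt_1 frac_gt_0_iff)
    \<comment> \<open>No other index hits \<open>frac g\<close>, so the jump there is a single
      weight and, with equal constants, determines the slope.\<close>
    have "orbit_one g k = ?p \<longleftrightarrow> k = 1" for k
      using orbit_one_no_return[OF g_rat g_int, of k] orbit_one_1[of g] by auto
    from kink_single[OF C(1) g(1) this]
    have "kink ?c g (orbit_one g) ?p = ?c / g" by simp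
    moreover have "orbit_one g' k = ?p \<longleftrightarrow> k = 1" for k
      unfolding frac_g using orbit_one_no_return[OF g'_rat g'_int, of k] orbit_one_1[of g'] by auto
    from kink_single[OF C(2) g(2) this]
    have "kink ?c' g' (orbit_one g') ?p = ?c' / g'" by simp
    ultimately have "?c / g = ?c' / g'" using kinks(1)[of ?p] p by simp
    then have gg: "g = g'" using c C g by (simp add: field_simps)
    \<comment> \<open>Likewise index 0 alone produces the jump at \<open>frac \<beta>\<close>; its
      size \<open>?c / \<beta>\<close> separates the bases.\<close>
    have "?s k = ?s 0 \<longleftrightarrow> k = 0" for k
      using orbit_one_image_no_return g_rat g_int unfolding g_def orbit_one_0 by blast
    from kink_single[OF D(1) g(1) this]
    have "kink (?c / \<beta>) g ?s (frac \<beta>) = ?c / \<beta>" unfolding s0 by simp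
    moreover have "?s' k = ?s' 0 \<longleftrightarrow> k = 0" for k
      using orbit_one_image_no_return g'_rat g'_int unfolding g'_def orbit_one_0 by blast
    from kink_single[OF D(2) g(2) this]
    have "kink (?c' / \<beta>') g' ?s' (frac \<beta>) = ?c' / \<beta>'" unfolding s0 frac_eq by simp
    ultimately have "?c / \<beta> = ?c' / \<beta>'" using kinks(2)[of "frac \<beta>"] frac_\<beta> by simp
    then have "\<beta> = \<beta>'" using c C n m by (simp add: field_simps)
    then have "n = m" using gg n(2) by (simp add: g_def g'_def)
    then show False using \<open>n \<noteq> m\<close> by simp
  qed
qed

end
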